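(* For each $n\in\mathbb N$ let $C=C(n)$ be a core on vertex set $[|C|]$ and $q=q(n)\in\mathbb N$ such that $\mathcal Q(C,q)$ is nonempty, let $Q$ be chosen uniformly at random from $\mathcal Q(C,q)$, and let $\varepsilon>0$. Suppose $\Delta(C)=\Theta(1)$. Then: (1) there is a constant $K$ such that with high probability $\Delta(Q)\le\mu(q)+K$; (2) if in addition $|C|=O(q^{1-\beta})$ for some fixed $\beta>0$, then with high probability $\lfloor\mu(q)-\varepsilon\rfloor+1\le\Delta(Q)\le\lfloor\mu(q)+\varepsilon\rfloor+1$.
   Context: A component is complex if it contains at least two cycles; a graph is complex if all its components are complex. A core is a graph of minimum degree at least two with no component that is a cycle. The core of a graph $H$ is the maximal subgraph of minimum degree at least two of the union of the complex components of $H$. $|C|$ is the number of vertices of $C$. $\mathcal Q(C,q)$ is the class of complex graphs with vertex set $[q]$ whose core is $C$. $\Delta$ denotes maximum degree. "With high probability" means with probability tending to $1$ as $n\to\infty$. $\mu(x)$ is the unique positive zero of $y\mapsto y-(y+1/2)\log y+\log x$ ($\log$ natural).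
   Formalization: The formal theorem additionally assumes q(n) → ∞ as n → ∞; without it the claim fails, e.g. for constant C = K_30 and q = 31, where Δ(Q) = 30 surely while μ(31) < 5. *)

theory Defs
  imports "HOL-Probability.Probability" "HOL-Library.Landau_Symbols"
    "HOL-Real_Asymp.Real_Asymp"
begin

datatype 'a ugraph = UGraph (verts: "'a set") (edges: "'a set set")

definition simple_graph :: "'a ugraph \<Rightarrow> bool" where
  "simple_graph G \<longleftrightarrow> finite (verts G) \<and> (\<forall>e\<in>edges G. e \<subseteq> verts G \<and> card e = 2)"

definition subgraph :: "'a ugraph \<Rightarrow> 'a ugraph \<Rightarrow> bool" where
  "subgraph H G \<longleftrightarrow> simple_graph H \<and> verts H \<subseteq> verts G \<and> edges H \<subseteq> edges G"

definition vertex_degree :: "'a ugraph \<Rightarrow> 'a \<Rightarrow> nat" where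
  "vertex_degree G v = card {e \<in> edges G. v \<in> e}"

text \<open>The graph without vertices gets maximum degree 0.\<close>

definition max_degree :: "'a ugraph \<Rightarrow> nat" where
  "max_degree G = Max (insert 0 (vertex_degree G ` verts G))"

definition min_degree_ge :: "'a ugraph \<Rightarrow> nat \<Rightarrow> bool" where
  "min_degree_ge G d \<longleftrightarrow> (\<forall>v\<in>verts G. d \<le> vertex_degree G v)"

definition adjacency :: "'a ugraph \<Rightarrow> ('a \<times> 'a) set" where
  "adjacency G = {(u, v). {u, v} \<in> edges G}"

definition component_of :: "'a ugraph \<Rightarrow> 'a \<Rightarrow> 'a ugraph" where
  "component_of G v =
     (let W = {u \<in> verts G. (v, u) \<in> (adjacency G)\<^sup>*} in UGraph W {e \<in> edges G. e \<subseteq> W})"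

definition graph_components :: "'a ugraph \<Rightarrow> 'a ugraph set" where
  "graph_components G = component_of G ` verts G"

definition is_cycle :: "'a ugraph \<Rightarrow> bool" where
  "is_cycle Z \<longleftrightarrow> (\<exists>vs. 3 \<le> length vs \<and> distinct vs \<and>
     Z = UGraph (set vs) {{vs ! i, vs ! (Suc i mod length vs)} | i. i < length vs})"

text \<open>Cycles are counted as subgraphs, i.e. without a starting point or an orientation.\<close>

definition has_two_cycles :: "'a ugraph \<Rightarrow> bool" where
  "has_two_cycles G \<longleftrightarrow>
     (\<exists>Z Z'. Z \<noteq> Z' \<and> is_cycle Z \<and> subgraph Z G \<and> is_cycle Z' \<and> subgraph Z' G)"

definition complex_graph :: "'a ugraph \<Rightarrow> bool" where
  "complex_graph G \<longleftrightarrow> simple_graph G \<and> (\<forall>K\<in>graph_components G. has_two_cycles K)"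

definition is_core :: "'a ugraph \<Rightarrow> bool" where
  "is_core C \<longleftrightarrow> simple_graph C \<and> min_degree_ge C 2 \<and> (\<forall>K\<in>graph_components C. \<not> is_cycle K)"

definition complex_part :: "'a ugraph \<Rightarrow> 'a ugraph" where
  "complex_part H =
     (let \<K> = {K \<in> graph_components H. has_two_cycles K}
      in UGraph (\<Union>K\<in>\<K>. verts K) (\<Union>K\<in>\<K>. edges K))"

definition core_of :: "'a ugraph \<Rightarrow> 'a ugraph \<Rightarrow> bool" where
  "core_of C H \<longleftrightarrow>
     subgraph C (complex_part H) \<and> min_degree_ge C 2 \<and>
     (\<forall>D. subgraph D (complex_part H) \<and> min_degree_ge D 2 \<and> subgraph C D \<longrightarrow> D = C)"

definition complex_with_core :: "nat ugraph \<Rightarrow> nat \<Rightarrow> nat ugraph set" where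
  "complex_with_core C q = {H. verts H = {1..q} \<and> complex_graph H \<and> core_of C H}"

definition \<mu> :: "real \<Rightarrow> real" where
  "\<mu> x = (THE y. 0 < y \<and> y - (y + 1 / 2) * ln y + ln x = 0)"

lemma finite_edges: "simple_graph G \<Longrightarrow> finite (edges G)"
  unfolding simple_graph_def by (meson Pow_iff finite_Pow_iff finite_subset subsetI)

lemma vertex_degree_mono:
  "subgraph H G \<Longrightarrow> simple_graph G \<Longrightarrow> vertex_degree H v \<le> vertex_degree G v"
  unfolding vertex_degree_def subgraph_def by (auto intro!: card_mono dest: finite_edges)

text \<open>A core of a graph, which is only required to be maximal, is unique, as the subgraphs of
  minimum degree at least two are closed under union.\<close>

lemma core_of_unique:
  assumes "core_of C H" "core_of C' H"
  shows "C = C'"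
proof -
  define D where "D = UGraph (verts C \<union> verts C') (edges C \<union> edges C')"
  have s: "simple_graph C" "simple_graph C'"
    using assms by (auto simp: core_of_def subgraph_def)
  then have D: "simple_graph D"
    by (auto simp: D_def simple_graph_def)
  have sub: "subgraph C D" "subgraph C' D" "subgraph D (complex_part H)"
    using assms s D by (auto simp: core_of_def subgraph_def D_def)
  have "2 \<le> vertex_degree D v" if "v \<in> verts D" for v
  proof -
    have "2 \<le> vertex_degree C v \<or> 2 \<le> vertex_degree C' v"
      using that assms by (auto simp: D_def core_of_def min_degree_ge_def)
    then show ?thesis
      using vertex_degree_mono[OF sub(1) D, of v] vertex_degree_mono[OF sub(2) D, of v] by linarith
  qed
  then have "min_degree_ge D 2"
    by (simp add: min_degree_ge_def)
  with assms sub show ?thesis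
    by (metis core_of_def)
qed

lemma finite_complex_with_core: "finite (complex_with_core C q)"
proof (rule finite_subset)
  show "complex_with_core C q \<subseteq> UGraph {1..q} ` Pow (Pow {1..q})"
  proof
    fix H assume "H \<in> complex_with_core C q"
    then have "H = UGraph {1..q} (edges H)" "edges H \<in> Pow (Pow {1..q})"
      by (auto simp: complex_with_core_def complex_graph_def simple_graph_def
        intro: ugraph.expand)
    then show "H \<in> UGraph {1..q} ` Pow (Pow {1..q})"
      by blast
  qed
qed simp

lemma \<mu>_exists_unique:
  assumes "0 < x"
  shows "\<exists>!y::real. 0 < y \<and> y - (y + 1 / 2) * ln y + ln x = 0"
proof -
  define f where "f y = y - (y + 1 / 2) * ln y + ln x" for y :: real
  have der: "(f has_real_derivative (- ln y - 1 / (2 * y))) (at y)" if "y > 0" for y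
    unfolding f_def using that by (auto intro!: derivative_eq_intros simp: field_simps)
  have neg: "- ln y - 1 / (2 * y) < 0" if "y > 0" for y :: real
  proof -
    have "exp 1 * (1 / (exp 1 * y)) \<le> exp (1 / (exp 1 * y) :: real)"
    proof -
      have "1 + (1 / (exp 1 * y) - 1) \<le> exp (1 / (exp 1 * y) - 1)"
        by (rule exp_ge_add_one_self)
      then have "exp 1 * (1 / (exp 1 * y)) \<le> exp 1 * exp (1 / (exp 1 * y) - 1)"
        by (intro mult_left_mono) auto
      then show ?thesis by (simp add: exp_add[symmetric])
    qed
    then have "ln (1 / y) \<le> ln (exp (1 / (exp 1 * y)))"
      using that by (subst ln_le_cancel_iff) auto
    then have "- ln y \<le> 1 / (exp 1 * y)"
      using that by (simp add: ln_div)
    also have "\<dots> < 1 / (2 * y)"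
    proof -
      have "2 < exp (1::real)" using exp_lower_Taylor_quadratic[of "1::real"] by simp
      with that show ?thesis by (simp add: field_simps)
    qed
    finally show ?thesis by simp
  qed
  have less: "f b < f a" if "0 < a" "a < b" for a b
    using that by (intro DERIV_neg_imp_decreasing[OF that(2)]) (meson der neg less_le_trans)
  have lim: "filterlim f at_top (at_right 0)" "filterlim f at_bot at_top"
    unfolding f_def by real_asymp+
  obtain a where a: "0 < a" "a < 1" "0 \<le> f a"
  proof -
    have "eventually (\<lambda>y. 0 \<le> f y) (at_right 0)"
      using lim(1) by (simp add: filterlim_at_top)
    moreover have "eventually (\<lambda>y::real. y \<in> {0<..<1}) (at_right 0)"
      by (rule eventually_at_right_real) simp
    ultimately have "eventually (\<lambda>y. 0 \<le> f y \<and> y \<in> {0<..<1}) (at_right 0)"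
      by (rule eventually_conj)
    then have "\<exists>y. 0 \<le> f y \<and> y \<in> {0<..<1}"
      by (rule eventually_happens'[rotated]) simp
    then show ?thesis
      using that by auto
  qed
  obtain b where b: "1 \<le> b" "f b \<le> 0"
  proof -
    have "eventually (\<lambda>y. f y \<le> 0) at_top"
      using lim(2) by (simp add: filterlim_at_bot)
    then obtain N where "\<And>y. N \<le> y \<Longrightarrow> f y \<le> 0"
      by (auto simp: eventually_at_top_linorder)
    then show ?thesis
      using that[of "max 1 N"] by simp
  qed
  have "\<exists>y\<ge>a. y \<le> b \<and> f y = 0"
    using a b by (intro IVT2) (auto intro!: DERIV_isCont[OF der])
  then obtain y where y: "0 < y" "f y = 0"
    using a(1) less_le_trans by blast
  have "z = y" if "0 < z" "f z = 0" for z
    using less[of y z] less[of z y] that y by (cases z y rule: linorder_cases) auto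
  with y show ?thesis
    unfolding f_def by blast
qed

end

theory Submission
  imports Defs "HOL-Computational_Algebra.Polynomial"
begin

text \<open>
  A complex graph with core \<open>C\<close> consists of \<open>C\<close> and a forest whose trees are rooted at the vertices
  of \<open>C\<close>. Weighting a forest by the product of \<open>x\<close> over all parents, the total weight of the forests
  with vertex set \<open>V\<close> and root set \<open>R\<close> is \<open>(\<Sum>r\<in>R. x r) * (\<Sum>v\<in>V. x v) ^ (card (V - R) - 1)\<close>, so
  the numbers of children behave like the loads of \<open>card V\<close> bins into which about \<open>card (V - R)\<close>
  balls are thrown. The expected number of bins of load at least \<open>d\<close> is at most about \<open>q / d!\<close>, and
  by Stirling's formula \<open>d!\<close> passes from \<open>o(q)\<close> to \<open>\<omega>(q)\<close> as \<open>d\<close> crosses a window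
  of constant width around \<open>\<mu>(q)\<close>. This gives the upper bounds; the lower bound is a second moment
  argument for the number of vertices outside the core with exactly \<open>d\<close> children.
\<close>

text \<open>The formula behaves as if \<open>card (V - R) - 1\<close> balls were thrown uniformly
  into \<open>V\<close> and one further ball uniformly into \<open>R\<close>, since some vertex must
  hang on a root. Counts are read off by substituting polynomials for the weights of one or two
  vertices, hence the commutative semiring.

  Besides the edges to its children a vertex outside the core has one edge, a core vertex up to
  \<open>\<Delta>(C)\<close>. In the first claim this bounded excess goes into \<open>K\<close>. In
  the second claim the threshold for core vertices is lowered by a constant \<open>M\<close>, which
  multiplies the tail by about \<open>\<mu>(q)^M\<close>. The bound on \<open>|C|\<close> gains
  \<open>q^(-\<beta>)\<close>, eventually at most \<open>exp (-\<beta> \<mu>(q))\<close> since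
  \<open>\<mu>(q) \<le> ln q\<close>, and this wins. The same bound keeps almost all vertices
  outside the core, as the lower bound requires.

  All that enters about \<open>\<mu>\<close> is that Stirling's approximation of
  \<open>ln (y!)\<close>, up to a constant, equals \<open>ln q\<close> at
  \<open>y = \<mu>(q)\<close>, and that its slope is about \<open>ln y\<close>. Hence a shift by
  \<open>\<epsilon>\<close> changes \<open>q / d!\<close> by a factor of about
  \<open>\<mu>(q)^\<epsilon>\<close>, which tends to infinity.\<close>

section \<open>Rooted forests\<close>

text \<open>\<open>p\<close> sends each non-root to its parent. The decreasing rank
  \<open>\<delta>\<close> excludes cycles, so following \<open>p\<close> ends in \<open>R\<close>;
  it is also the measure of later inductions. Extensionality makes each forest a single function, so
  that counting functions counts forests.\<close>

definition rooted_forests :: "'a set \<Rightarrow> 'a set \<Rightarrow> ('a \<Rightarrow> 'a) set" where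
  "rooted_forests V R =
     {p \<in> (V - R) \<rightarrow>\<^sub>E V. \<exists>\<delta>::'a \<Rightarrow> nat. \<forall>v\<in>V - R. \<delta> (p v) < \<delta> v}"

definition child_count :: "'a set \<Rightarrow> 'a set \<Rightarrow> ('a \<Rightarrow> 'a) \<Rightarrow> 'a \<Rightarrow> nat" where
  "child_count V R p v = card {u \<in> V - R. p u = v}"

lemma finite_rooted_forests: "finite V \<Longrightarrow> finite (rooted_forests V R)"
  by (rule finite_subset[of _ "(V - R) \<rightarrow>\<^sub>E V"]) (auto simp: rooted_forests_def intro!: finite_PiE)

lemma rooted_forests_self: "rooted_forests V V = {\<lambda>_. undefined}"
  by (auto simp: rooted_forests_def)

lemma rooted_forests_no_roots:
  assumes "V \<noteq> {}"
  shows "rooted_forests V {} = {}"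
proof -
  have False if p: "p \<in> V \<rightarrow>\<^sub>E V" "\<forall>v\<in>V. \<delta> (p v) < \<delta> v" for p and \<delta> :: "'a \<Rightarrow> nat"
  proof -
    obtain v where v: "v \<in> V" "\<And>w. w \<in> V \<Longrightarrow> \<delta> v \<le> \<delta> w"
      using assms arg_min_natI[of "\<lambda>v. v \<in> V" _ \<delta>] arg_min_nat_le[of "\<lambda>v. v \<in> V" _ \<delta>] by blast
    show False
      using p v(1) v(2)[of "p v"] by (auto simp: not_le[symmetric])
  qed
  then show ?thesis
    unfolding rooted_forests_def Diff_empty by blast
qed

text \<open>A forest is cut below its roots: \<open>S\<close> is the set of children of roots, each
  of which picks its parent in \<open>R\<close> independently, and the rest is a forest on
  \<open>V - R\<close> with root set \<open>S\<close>. The independent choices give the power of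
  \<open>sum x R\<close>.\<close>

lemma rooted_forests_sum_by_level:
  fixes x :: "'a \<Rightarrow> 'b::comm_semiring_1"
  assumes "finite V" "R \<subseteq> V"
  shows "(\<Sum>p\<in>rooted_forests V R. \<Prod>u\<in>V - R. x (p u)) =
    (\<Sum>S\<in>Pow (V - R). sum x R ^ card S *
      (\<Sum>g\<in>rooted_forests (V - R) S. \<Prod>u\<in>V - R - S. x (g u)))"
proof -
  define W where "W = V - R"
  define T where "T = (SIGMA S:Pow W. (S \<rightarrow>\<^sub>E R) \<times> rooted_forests W S)"
  define glue where "glue = (\<lambda>(S, f :: 'a \<Rightarrow> 'a, g) u. if u \<in> S then f u else g u)"
  define level where "level p = {u \<in> W. p u \<in> R}" for p :: "'a \<Rightarrow> 'a"
  have W: "finite W" "W \<inter> R = {}" "W \<subseteq> V" "V - R = W" "V = R \<union> W"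
    using assms by (auto simp: W_def)
  have "(\<Sum>p\<in>rooted_forests V R. \<Prod>u\<in>W. x (p u)) =
    (\<Sum>(S, f, g)\<in>T. (\<Prod>u\<in>S. x (f u)) * (\<Prod>u\<in>W - S. x (g u)))"
  proof (rule sum.reindex_bij_witness[where
        j = "\<lambda>p. (level p, restrict p (level p), restrict p (W - level p))" and i = glue], goal_cases)
    case (1 p)
    then have "p \<in> extensional W"
      by (auto simp: rooted_forests_def W(4) PiE_def)
    then show ?case
      by (auto simp: glue_def level_def extensional_def restrict_def fun_eq_iff)
  next
    case (2 p)
    then obtain \<delta> :: "'a \<Rightarrow> nat" where p: "p \<in> W \<rightarrow>\<^sub>E V" "\<forall>v\<in>W. \<delta> (p v) < \<delta> v"
      by (auto simp: rooted_forests_def W(4))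
    have "restrict p (W - level p) \<in> rooted_forests W (level p)"
      using p W(5) by (auto simp: rooted_forests_def level_def intro!: exI[of _ \<delta>])
    then show ?case
      by (auto simp: T_def level_def)
  next
    case (3 t)
    then obtain S f g where t: "t = (S, f, g)" "S \<subseteq> W" "f \<in> S \<rightarrow>\<^sub>E R" "g \<in> (W - S) \<rightarrow>\<^sub>E W"
      by (auto simp: T_def rooted_forests_def)
    have f: "f u \<in> R" if "u \<in> S" for u using t that by auto
    have g: "g u \<in> W" if "u \<in> W" "u \<notin> S" for u using t that by auto
    have "level (glue t) = S"
      using f g t(2) W(2) by (auto simp: level_def glue_def t(1))
    moreover have "restrict (glue t) S = f" "restrict (glue t) (W - S) = g"
      using t by (auto simp: glue_def restrict_def fun_eq_iff PiE_def extensional_def)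
    ultimately show ?case by (simp add: t(1))
  next
    case (4 t)
    then obtain S f g \<delta> where t: "t = (S, f, g)" "S \<subseteq> W" "f \<in> S \<rightarrow>\<^sub>E R" "g \<in> (W - S) \<rightarrow>\<^sub>E W"
      and \<delta>: "\<forall>v\<in>W - S. \<delta> (g v) < (\<delta> v :: nat)"
      by (auto simp: T_def rooted_forests_def)
    have f: "f u \<in> R" if "u \<in> S" for u using t that by auto
    have g: "g u \<in> W" if "u \<in> W" "u \<notin> S" for u using t that by auto
    \<comment> \<open>The rank of the lower forest is raised by one to make room for the roots at
      rank 0.\<close>
    define \<delta>' where "\<delta>' v = (if v \<in> R then 0 else Suc (\<delta> v))" for v
    have "\<forall>v\<in>W. \<delta>' (glue t v) < \<delta>' v"
      using f g \<delta> W(2) by (auto simp: \<delta>'_def glue_def t(1))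
    moreover have "glue t \<in> W \<rightarrow>\<^sub>E V"
      using subsetD[OF assms(2) f] subsetD[OF W(3) g] t(1-4)
      by (auto simp: glue_def PiE_def extensional_def)
    ultimately show ?case
      unfolding rooted_forests_def W(4) by blast
  next
    case (5 p)
    have "level p \<subseteq> W" by (auto simp: level_def)
    then have "(\<Prod>u\<in>W. x (p u)) = (\<Prod>u\<in>level p. x (p u)) * (\<Prod>u\<in>W - level p. x (p u))"
      using W(1) by (metis mult.commute prod.subset_diff)
    then show ?case by simp
  qed
  also have "\<dots> = (\<Sum>S\<in>Pow W. \<Sum>(f, g)\<in>(S \<rightarrow>\<^sub>E R) \<times> rooted_forests W S.
      (\<Prod>u\<in>S. x (f u)) * (\<Prod>u\<in>W - S. x (g u)))"
  proof -
    have "finite ((S \<rightarrow>\<^sub>E R) \<times> rooted_forests W S)" if "S \<in> Pow W" for S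
      using that assms W finite_rooted_forests[OF W(1)]
      by (intro finite_cartesian_product finite_PiE) (auto intro: finite_subset)
    then show ?thesis
      unfolding T_def using W(1) by (subst sum.Sigma) (auto simp: case_prod_unfold)
  qed
  also have "\<dots> = (\<Sum>S\<in>Pow W. (\<Sum>f\<in>S \<rightarrow>\<^sub>E R. \<Prod>u\<in>S. x (f u)) *
      (\<Sum>g\<in>rooted_forests W S. \<Prod>u\<in>W - S. x (g u)))"
    by (simp add: sum_product sum.cartesian_product)
  also have "\<dots> = (\<Sum>S\<in>Pow W. sum x R ^ card S *
      (\<Sum>g\<in>rooted_forests W S. \<Prod>u\<in>W - S. x (g u)))"
  proof (intro sum.cong refl)
    fix S assume "S \<in> Pow W"
    then have "finite S" "finite R" using W(1) assms by (auto intro: finite_subset)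
    then have "(\<Sum>f\<in>S \<rightarrow>\<^sub>E R. \<Prod>u\<in>S. x (f u)) = sum x R ^ card S"
      by (subst prod_sum_PiE[symmetric]) auto
    then show "(\<Sum>f\<in>S \<rightarrow>\<^sub>E R. \<Prod>u\<in>S. x (f u)) *
      (\<Sum>g\<in>rooted_forests W S. \<Prod>u\<in>W - S. x (g u)) = sum x R ^ card S *
      (\<Sum>g\<in>rooted_forests W S. \<Prod>u\<in>W - S. x (g u))" by simp
  qed
  finally show ?thesis by (simp add: W(4))
qed

lemma sum_Pow_card:
  fixes f :: "nat \<Rightarrow> 'b::comm_semiring_1"
  assumes "finite U"
  shows "(\<Sum>T\<in>Pow U. f (card T)) = (\<Sum>j\<le>card U. of_nat (card U choose j) * f j)"
proof -
  have "(\<Sum>T\<in>Pow U. f (card T)) = (\<Sum>j\<le>card U. \<Sum>T\<in>{T \<in> Pow U. card T = j}. f (card T))"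
    using assms by (intro sum.group[symmetric]) (auto intro: card_mono)
  also have "\<dots> = (\<Sum>j\<le>card U. of_nat (card U choose j) * f j)"
    using n_subsets[OF assms] by (intro sum.cong refl) simp
  finally show ?thesis .
qed

text \<open>Double counting: a fixed \<open>s \<in> W\<close> lies in
  \<open>card W - 1 choose j\<close> subsets of size \<open>Suc j\<close>.\<close>

lemma sum_Pow_sum_card:
  fixes f :: "nat \<Rightarrow> 'b::comm_semiring_1" and x :: "'a \<Rightarrow> 'b"
  assumes "finite W"
  shows "(\<Sum>S\<in>Pow W. sum x S * f (card S)) =
    sum x W * (\<Sum>j\<le>card W - 1. of_nat (card W - 1 choose j) * f (Suc j))"
proof -
  have "(\<Sum>S\<in>Pow W. sum x S * f (card S)) = (\<Sum>S\<in>Pow W. \<Sum>s\<in>{s\<in>W. s \<in> S}. x s * f (card S))"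
    by (intro sum.cong refl) (auto simp: sum_distrib_right intro!: sum.cong)
  also have "\<dots> = (\<Sum>s\<in>W. \<Sum>S\<in>{S\<in>Pow W. s \<in> S}. x s * f (card S))"
    using assms by (intro sum.swap_restrict) auto
  also have "\<dots> = (\<Sum>s\<in>W. x s * (\<Sum>j\<le>card W - 1. of_nat (card W - 1 choose j) * f (Suc j)))"
  proof (intro sum.cong refl)
    fix s assume s: "s \<in> W"
    have "(\<Sum>S\<in>{S\<in>Pow W. s \<in> S}. x s * f (card S)) =
      (\<Sum>T\<in>Pow (W - {s}). x s * f (card (insert s T)))"
      using s by (intro sum.reindex_bij_witness[where i = "insert s" and j = "\<lambda>S. S - {s}"])
        (auto simp: insert_absorb)
    also have "\<dots> = (\<Sum>T\<in>Pow (W - {s}). x s * f (Suc (card T)))"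
    proof (intro sum.cong refl)
      fix T assume "T \<in> Pow (W - {s})"
      then have "finite T" "s \<notin> T" using assms by (auto intro: finite_subset)
      then show "x s * f (card (insert s T)) = x s * f (Suc (card T))" by simp
    qed
    finally show "(\<Sum>S\<in>{S\<in>Pow W. s \<in> S}. x s * f (card S)) =
      x s * (\<Sum>j\<le>card W - 1. of_nat (card W - 1 choose j) * f (Suc j))"
      using s assms sum_Pow_card[of "W - {s}" "\<lambda>j. f (Suc j)"]
      by (simp add: sum_distrib_left[symmetric])
  qed
  finally show ?thesis by (simp add: sum_distrib_right)
qed

text \<open>A weighted form of Cayley's formula. Once the children of the roots are cut off, the
  induction hypothesis contributes a factor \<open>sum x S\<close>; summing over \<open>S\<close>
  turns it into \<open>sum x W\<close>, and the binomial theorem collects the powers of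
  \<open>sum x R\<close> and \<open>sum x W\<close> into a power of \<open>sum x V\<close>.\<close>

theorem rooted_forests_generating_function:
  fixes x :: "'a \<Rightarrow> 'b::comm_semiring_1"
  assumes "finite V" "R \<subseteq> V"
  shows "(\<Sum>p\<in>rooted_forests V R. \<Prod>u\<in>V - R. x (p u)) =
    (if V = R then 1 else sum x R * sum x V ^ (card (V - R) - 1))"
  using assms
proof (induction "card V" arbitrary: V R rule: less_induct)
  case less
  consider "V = R" | "V \<noteq> R" "R = {}" | "V \<noteq> R" "R \<noteq> {}" by blast
  then show ?case
  proof cases
    case 1
    then show ?thesis by (simp add: rooted_forests_self)
  next
    case 2
    then show ?thesis by (simp add: rooted_forests_no_roots)
  next
    case 3
    define W a b where "W = V - R" and "a = sum x R" and "b = sum x W"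
    define M where "M = card W - 1"
    have W: "finite W" "W \<noteq> {}" "card W < card V"
      using less.prems 3 by (auto simp: W_def intro!: psubset_card_mono)
    then have M: "card W = Suc M"
      by (simp add: M_def card_gt_0_iff)
    have ab: "sum x V = a + b"
      using less.prems unfolding a_def b_def W_def by (metis add.commute sum.subset_diff)
    \<comment> \<open>For \<open>S = W\<close> the lower forest has no edges and weight 1, which
      does not fit the pattern. This term is split off and returns as the last term,
      \<open>j = M\<close>, of the binomial sum.\<close>
    define f where "f j = (if j = card W then 0 else a ^ j * b ^ (M - j))" for j
    have "(\<Sum>p\<in>rooted_forests V R. \<Prod>u\<in>V - R. x (p u)) =
      (\<Sum>S\<in>Pow W. a ^ card S * (\<Sum>g\<in>rooted_forests W S. \<Prod>u\<in>W - S. x (g u)))"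
      using rooted_forests_sum_by_level[OF less.prems] by (simp add: W_def a_def)
    also have "\<dots> = (\<Sum>S\<in>Pow W. sum x S * f (card S) + (if S = W then a ^ card W else 0))"
    proof (intro sum.cong refl)
      fix S assume S: "S \<in> Pow W"
      have IH: "(\<Sum>g\<in>rooted_forests W S. \<Prod>u\<in>W - S. x (g u)) =
        (if W = S then 1 else sum x S * b ^ (card (W - S) - 1))"
        using less.hyps[of W S] W S by (simp add: b_def)
      have "card S < card W" "card (W - S) - 1 = M - card S" if "S \<noteq> W"
      proof -
        show "card S < card W" using that S W(1) by (intro psubset_card_mono) auto
        show "card (W - S) - 1 = M - card S"
          using S W(1) by (simp add: card_Diff_subset finite_subset M_def)
      qed
      then show "a ^ card S * (\<Sum>g\<in>rooted_forests W S. \<Prod>u\<in>W - S. x (g u)) =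
        sum x S * f (card S) + (if S = W then a ^ card W else 0)"
        unfolding IH by (cases "S = W") (auto simp: f_def mult_ac)
    qed
    also have "\<dots> = b * (\<Sum>j\<le>M. of_nat (M choose j) * f (Suc j)) + a ^ Suc M"
      using W(1) sum_Pow_sum_card[OF W(1), of x f]
      by (simp add: sum.distrib M b_def sum.delta')
    also have "(\<Sum>j\<le>M. of_nat (M choose j) * f (Suc j)) =
      (\<Sum>j<M. of_nat (M choose j) * (a ^ Suc j * b ^ (M - Suc j)))"
      by (simp add: lessThan_Suc_atMost[symmetric] f_def M)
    also have "b * \<dots> = (\<Sum>j<M. a * (of_nat (M choose j) * a ^ j * b ^ (M - j)))"
      unfolding sum_distrib_left
    proof (intro sum.cong refl)
      fix j assume "j \<in> {..<M}"
      then have "b ^ (M - j) = b * b ^ (M - Suc j)"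
        by (metis Suc_diff_Suc lessThan_iff power_Suc)
      then show "b * (of_nat (M choose j) * (a ^ Suc j * b ^ (M - Suc j))) =
        a * (of_nat (M choose j) * a ^ j * b ^ (M - j))"
        by (simp add: mult_ac)
    qed
    also have "\<dots> + a ^ Suc M = a * (\<Sum>j\<le>M. of_nat (M choose j) * a ^ j * b ^ (M - j))"
      by (simp add: lessThan_Suc_atMost[symmetric] distrib_left sum_distrib_left)
    also have "\<dots> = a * (a + b) ^ M"
      by (simp add: binomial_ring)
    finally show ?thesis
      using 3 by (simp add: ab M_def W_def[symmetric] a_def[symmetric])
  qed
qed

section \<open>Numbers of children in a random forest\<close>

lemma child_count_self: "child_count V V p v = 0"
  by (simp add: child_count_def)

lemma card_rooted_forests:
  assumes "finite V" "R \<subset> V"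
  shows "card (rooted_forests V R) = card R * card V ^ (card (V - R) - 1)"
  using rooted_forests_generating_function[of V R "\<lambda>_. 1 :: nat"] assms by (simp add: psubset_eq split: if_splits)

lemma prod_eq_power_child_count:
  assumes "finite V"
  shows "(\<Prod>u\<in>V - R. if p u = v then y else 1) = (y :: 'b::comm_monoid_mult) ^ child_count V R p v"
  using assms by (simp add: child_count_def prod.If_cases Int_def)

section \<open>Marked vertices and the upper tail of the numbers of children\<close>

lemma coeff_linear_power:
  fixes c :: "'a::comm_semiring_1"
  shows "coeff ((monom 1 1 + [:c:]) ^ m) d = of_nat (m choose d) * c ^ (m - d)"
proof -
  have "(monom 1 1 + [:c:]) ^ m = (\<Sum>j\<le>m. monom (of_nat (m choose j) * c ^ (m - j)) j)"
    unfolding binomial_ring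
  proof (intro sum.cong refl)
    fix j
    have "[:c:] ^ i = monom (c ^ i) 0" for i
      by (simp add: monom_0[symmetric] monom_power)
    then show "of_nat (m choose j) * monom 1 1 ^ j * [:c:] ^ (m - j) =
        monom (of_nat (m choose j) * c ^ (m - j)) j"
      by (simp add: monom_power of_nat_monom mult_monom)
  qed
  then have "coeff ((monom 1 1 + [:c:]) ^ m) d =
      (\<Sum>j\<le>m. if j = d then of_nat (m choose j) * c ^ (m - j) else 0)"
    by (simp add: coeff_sum)
  then show ?thesis
    by (simp add: binomial_eq_0)
qed

lemma coeff_of_nat_mult: "coeff (of_nat n * P) j = of_nat n * coeff P j"
  by (simp add: of_nat_poly)

lemma coeff_X_mult: "coeff (monom 1 1 * (P :: 'a::comm_semiring_1 poly)) (Suc e) = coeff P e"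
  by (simp add: monom_Suc monom_0)

lemma sum_eq_add_diff_singleton:
  assumes "finite A" "v \<in> A" "\<And>w. w \<in> A - {v} \<Longrightarrow> f w = (1 :: 'b::comm_semiring_1)"
  shows "sum f A = f v + of_nat (card A - 1)"
  using assms by (simp add: sum.remove[of A v])

lemma sum_eq_of_nat_card:
  "(\<And>w. w \<in> A \<Longrightarrow> f w = (1 :: 'b::comm_semiring_1)) \<Longrightarrow> sum f A = of_nat (card A)"
  by simp

text \<open>Marking \<open>v\<close> by \<open>X + 1\<close> instead of \<open>X\<close> makes the
  coefficients of \<open>(X + 1) ^ c\<close> the numbers \<open>c choose j\<close>, so a binomial
  moment can be read off. A root \<open>v\<close> is marked in the factor \<open>sum x R\<close>
  too, whence the second summand.\<close>

lemma sum_child_count_choose: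
  assumes "finite V" "R \<subset> V" "v \<in> V"
  defines "m \<equiv> card (V - R) - 1"
  shows "(\<Sum>p\<in>rooted_forests V R. child_count V R p v choose Suc e) =
    card R * ((m choose Suc e) * card V ^ (m - Suc e)) +
    (if v \<in> R then (m choose e) * card V ^ (m - e) else 0)"
proof -
  define X where "X = (monom 1 1 :: nat poly)"
  define x where "x w = (if w = v then X + [:1:] else 1)" for w
  have fin: "finite R" using assms finite_subset by blast
  have sum_x: "sum x A = X + [:card A:]" if "finite A" "v \<in> A" for A
  proof -
    have "[:1:] + of_nat (card A - 1) = [:card A:]"
      using that card_gt_0_iff[of A] by (auto simp: of_nat_poly)
    then show ?thesis
      using that sum_eq_add_diff_singleton[of A v x] by (simp add: x_def add.assoc)
  qed
  have V: "sum x V = X + [:card V:]"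
    using sum_x assms by simp
  have "sum x R = of_nat (card R)" if "v \<notin> R"
    using that by (intro sum_eq_of_nat_card) (auto simp: x_def)
  then have R: "sum x R = (if v \<in> R then X + [:card R:] else [:card R:])"
    using sum_x fin by (simp add: of_nat_poly)
  have "(\<Sum>p\<in>rooted_forests V R. (X + [:1:]) ^ child_count V R p v) =
    (\<Sum>p\<in>rooted_forests V R. \<Prod>u\<in>V - R. x (p u))"
    by (simp add: prod_eq_power_child_count[OF assms(1)] x_def)
  also have "\<dots> = sum x R * (X + [:card V:]) ^ m"
    using assms by (subst rooted_forests_generating_function) (auto simp: V m_def)
  finally have "coeff (\<Sum>p\<in>rooted_forests V R. (X + [:1:]) ^ child_count V R p v) (Suc e) =
    coeff (sum x R * (X + [:card V:]) ^ m) (Suc e)" by simp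
  moreover have "coeff (X * P) (Suc e) = coeff P e" for P
    unfolding X_def by (rule coeff_X_mult)
  moreover have "coeff ((X + [:c:]) ^ n) j = (n choose j) * c ^ (n - j)" for c n j
    unfolding X_def coeff_linear_power of_nat_id ..
  ultimately show ?thesis
    unfolding R by (auto simp: coeff_sum distrib_right simp del: One_nat_def)
qed

lemma choose_mult_power_le:
  assumes "m \<le> n"
  shows "real ((m choose d) * n ^ (m - d)) \<le> real n ^ m / fact d"
proof (cases "d \<le> m")
  case True
  have "(m choose d) * fact d * n ^ (m - d) \<le> n ^ d * n ^ (m - d)"
    using binomial_fact_pow[of m d] power_mono[OF assms, of d] by (intro mult_right_mono) auto
  also have "\<dots> = n ^ m" using True by (simp add: power_add[symmetric])
  finally have "real ((m choose d) * fact d * n ^ (m - d)) \<le> real (n ^ m)"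
    by (simp only: of_nat_le_iff)
  then show ?thesis
    by (simp add: field_simps)
qed (simp add: binomial_eq_0)

text \<open>Markov's inequality for the binomial moment, as \<open>c choose Suc e\<close> is at
  least 1 when \<open>Suc e \<le> c\<close>. The second term is due to the one ball reserved for the
  roots, which hits a given root with probability \<open>1 / card R\<close>.\<close>

lemma child_count_tail:
  assumes "finite V" "R \<subseteq> V" "R \<noteq> {}" "v \<in> V"
  shows "real (card {p \<in> rooted_forests V R. Suc e \<le> child_count V R p v}) \<le>
    real (card (rooted_forests V R)) *
      (1 / fact (Suc e) + (if v \<in> R then 1 / (real (card R) * fact e) else 0))"
proof (cases "V = R")
  case True
  then show ?thesis by (simp add: child_count_self)
next
  case False
  then have R: "R \<subset> V" using assms by blast
  define m where "m = card (V - R) - 1"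
  have fin: "finite (rooted_forests V R)" "finite R"
    using assms finite_rooted_forests finite_subset by blast+
  have m: "m \<le> card V"
    using assms card_mono[of V "V - R"] by (auto simp: m_def)
  have k: "0 < card R" using assms fin by (simp add: card_gt_0_iff)
  have "card {p \<in> rooted_forests V R. Suc e \<le> child_count V R p v} =
    (\<Sum>p\<in>rooted_forests V R. if Suc e \<le> child_count V R p v then 1 else 0)"
    using fin(1) by (simp add: sum.If_cases Int_def)
  also have "\<dots> \<le> (\<Sum>p\<in>rooted_forests V R. child_count V R p v choose Suc e)"
    by (intro sum_mono) (simp add: zero_less_binomial Suc_leI)
  also have "\<dots> = card R * ((m choose Suc e) * card V ^ (m - Suc e)) +
    (if v \<in> R then (m choose e) * card V ^ (m - e) else 0)"
    unfolding m_def by (rule sum_child_count_choose[OF assms(1) R assms(4)])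
  finally have "real (card {p \<in> rooted_forests V R. Suc e \<le> child_count V R p v}) \<le>
    real (card R * ((m choose Suc e) * card V ^ (m - Suc e)) +
    (if v \<in> R then (m choose e) * card V ^ (m - e) else 0))"
    by (simp only: of_nat_le_iff)
  also have "\<dots> = real (card R) * real ((m choose Suc e) * card V ^ (m - Suc e)) +
    (if v \<in> R then real ((m choose e) * card V ^ (m - e)) else 0)"
    by simp
  also have "\<dots> \<le> real (card R) * (real (card V) ^ m / fact (Suc e)) +
    (if v \<in> R then real (card V) ^ m / fact e else 0)"
    using choose_mult_power_le[OF m] by (intro add_mono mult_left_mono) (auto simp del: fact_Suc)
  also have "\<dots> = real (card (rooted_forests V R)) *
      (1 / fact (Suc e) + (if v \<in> R then 1 / (real (card R) * fact e) else 0))"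
    using k card_rooted_forests[OF assms(1) R]
    by (simp add: m_def distrib_left del: fact_Suc)
  finally show ?thesis .
qed

text \<open>Union bound. The extra terms of the roots add up to at most \<open>1 / fact e\<close>,
  since at most \<open>card R\<close> of them carry the factor \<open>1 / card R\<close>. The set
  \<open>A\<close> is general so that roots can later be treated with a threshold of their
  own.\<close>

lemma child_count_max_tail:
  assumes "finite V" "R \<subseteq> V" "R \<noteq> {}" "A \<subseteq> V"
  shows "real (card {p \<in> rooted_forests V R. \<exists>v\<in>A. Suc e \<le> child_count V R p v}) \<le>
    real (card (rooted_forests V R)) * (real (card A) / fact (Suc e) + 1 / fact e)"
proof -
  let ?F = "rooted_forests V R"
  have fin: "finite A" "finite R" using assms finite_subset by blast+
  have "{p \<in> ?F. \<exists>v\<in>A. Suc e \<le> child_count V R p v} =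
    (\<Union>v\<in>A. {p \<in> ?F. Suc e \<le> child_count V R p v})" by auto
  then have "real (card {p \<in> ?F. \<exists>v\<in>A. Suc e \<le> child_count V R p v}) \<le>
    (\<Sum>v\<in>A. real (card {p \<in> ?F. Suc e \<le> child_count V R p v}))"
    using card_UN_le[OF fin(1), of "\<lambda>v. {p \<in> ?F. Suc e \<le> child_count V R p v}"]
    by (simp only: of_nat_sum[symmetric] of_nat_le_iff)
  also have "\<dots> \<le> (\<Sum>v\<in>A. real (card ?F) *
      (1 / fact (Suc e) + (if v \<in> R then 1 / (real (card R) * fact e) else 0)))"
    using assms by (intro sum_mono child_count_tail) auto
  also have "\<dots> = real (card ?F) * (real (card A) / fact (Suc e) +
      (\<Sum>v\<in>A \<inter> R. 1 / (real (card R) * fact e)))"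
    using sum.inter_restrict[OF fin(1), of "\<lambda>_. 1 / (real (card R) * fact e)" R, symmetric]
    by (simp add: sum_distrib_left[symmetric] sum.distrib del: fact_Suc)
  also have "(\<Sum>v\<in>A \<inter> R. 1 / (real (card R) * fact e)) \<le> (1 :: real) / fact e"
  proof -
    have "card (A \<inter> R) \<le> card R" using fin by (intro card_mono) auto
    moreover have "0 < card R" using assms fin by (simp add: card_gt_0_iff)
    ultimately show ?thesis by (simp add: field_simps)
  qed
  finally show ?thesis by (simp add: mult_left_mono)
qed

section \<open>Exact numbers of children and the second moment\<close>

lemma card_child_count_eq:
  assumes "finite V" "R \<subset> V" "v \<in> V - R"
  defines "m \<equiv> card (V - R) - 1"
  shows "card {p \<in> rooted_forests V R. child_count V R p v = d} =
    card R * ((m choose d) * (card V - 1) ^ (m - d))"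
proof -
  define X where "X = (monom 1 1 :: nat poly)"
  define x where "x w = (if w = v then X else 1)" for w
  have V: "sum x V = X + [:card V - 1:]"
    using assms sum_eq_add_diff_singleton[of V v x] by (auto simp: x_def of_nat_poly)
  have R: "sum x R = of_nat (card R)"
    using assms by (intro sum_eq_of_nat_card) (auto simp: x_def)
  have "(\<Sum>p\<in>rooted_forests V R. X ^ child_count V R p v) =
    (\<Sum>p\<in>rooted_forests V R. \<Prod>u\<in>V - R. x (p u))"
    by (simp add: prod_eq_power_child_count[OF assms(1)] x_def)
  also have "\<dots> = of_nat (card R) * (X + [:card V - 1:]) ^ m"
    using assms by (subst rooted_forests_generating_function) (auto simp: V R m_def)
  finally have "coeff (\<Sum>p\<in>rooted_forests V R. X ^ child_count V R p v) d =
    of_nat (card R) * (of_nat (m choose d) * (card V - 1) ^ (m - d))"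
    by (simp only: X_def coeff_of_nat_mult coeff_linear_power)
  then show ?thesis
    using finite_rooted_forests[OF assms(1)]
    by (simp add: coeff_sum X_def monom_power sum.If_cases Int_def)
qed

text \<open>The two marks are kept apart by nesting: the outer variable \<open>Y\<close> marks
  \<open>u\<close>, and \<open>[:X:]\<close>, a constant with respect to \<open>Y\<close>, marks
  \<open>v\<close>. Taking a coefficient twice gives the joint count.\<close>

lemma card_child_count_eq2:
  assumes "finite V" "R \<subset> V" "u \<in> V - R" "v \<in> V - R" "u \<noteq> v"
  defines "m \<equiv> card (V - R) - 1"
  shows "card {p \<in> rooted_forests V R. child_count V R p u = d \<and> child_count V R p v = d} =
    card R * ((m choose d) * ((m - d choose d) * (card V - 2) ^ (m - d - d)))"
proof -
  define X where "X = (monom 1 1 :: nat poly)"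
  define Y where "Y = (monom 1 1 :: nat poly poly)"
  define x where "x w = (if w = u then Y else 1) * (if w = v then [:X:] else 1)" for w
  have "sum x V = x u + sum x (V - {u})"
    using assms by (simp add: sum.remove)
  also have "sum x (V - {u}) = x v + of_nat (card (V - {u}) - 1)"
    using assms by (intro sum_eq_add_diff_singleton) (auto simp: x_def)
  finally have V: "sum x V = Y + [:X + [:card V - 2:]:]"
    using assms by (simp add: x_def of_nat_poly numeral_2_eq_2)
  have R: "sum x R = of_nat (card R)"
    using assms by (intro sum_eq_of_nat_card) (auto simp: x_def)
  have "(\<Sum>p\<in>rooted_forests V R. Y ^ child_count V R p u * [:X:] ^ child_count V R p v) =
    (\<Sum>p\<in>rooted_forests V R. \<Prod>w\<in>V - R. x (p w))"
    by (simp add: prod_eq_power_child_count[OF assms(1)] x_def prod.distrib)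
  also have "\<dots> = of_nat (card R) * (Y + [:X + [:card V - 2:]:]) ^ m"
    using assms by (subst rooted_forests_generating_function) (auto simp: V R m_def)
  finally have "coeff (coeff (\<Sum>p\<in>rooted_forests V R.
      Y ^ child_count V R p u * [:X:] ^ child_count V R p v) d) d =
    coeff (coeff (of_nat (card R) * (Y + [:X + [:card V - 2:]:]) ^ m) d) d" by simp
  moreover have "coeff (coeff (Y ^ i * [:X:] ^ j) d) d = (if i = d \<and> j = d then 1 else 0)" for i j
  proof -
    have "[:X:] ^ j = monom (X ^ j) 0"
      by (simp add: monom_0[symmetric] monom_power)
    then show ?thesis
      by (simp add: Y_def X_def monom_power mult_monom)
  qed
  ultimately have "(\<Sum>p\<in>rooted_forests V R. if child_count V R p u = d \<and> child_count V R p v = d then 1 else 0) =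
    coeff (coeff (of_nat (card R) * (Y + [:X + [:card V - 2:]:]) ^ m) d) d"
    by (simp add: coeff_sum)
  also have "\<dots> = card R * ((m choose d) * ((m - d choose d) * (card V - 2) ^ (m - d - d)))"
    unfolding X_def Y_def coeff_of_nat_mult coeff_linear_power of_nat_id ..
  finally show ?thesis
    using finite_rooted_forests[OF assms(1)] by (simp add: sum.If_cases Int_def)
qed

text \<open>Chebyshev's inequality for the number of those \<open>v \<in> W\<close> with \<open>P v p\<close>, for uniform \<open>p\<close>.\<close>

lemma second_moment_card:
  fixes P :: "'a \<Rightarrow> 'b \<Rightarrow> bool" and a b :: real
  assumes "finite \<Omega>" "\<Omega> \<noteq> {}" "finite W" "W \<noteq> {}" "0 < a" and b0: "0 \<le> b"
    and a: "\<And>v. v \<in> W \<Longrightarrow> real (card {p \<in> \<Omega>. P v p}) = a"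
    and b: "\<And>u v. u \<in> W \<Longrightarrow> v \<in> W \<Longrightarrow> u \<noteq> v \<Longrightarrow> real (card {p \<in> \<Omega>. P u p \<and> P v p}) \<le> b"
  shows "real (card {p \<in> \<Omega>. \<forall>v\<in>W. \<not> P v p}) / card \<Omega> \<le>
    card \<Omega> / (card W * a) + card \<Omega> * b / a\<^sup>2 - 1"
proof -
  define F N where "F = real (card \<Omega>)" and "N = real (card W)"
  have F: "0 < F" and N: "0 < N"
    using assms by (auto simp: F_def N_def card_gt_0_iff)
  define I where "I v p = (if P v p then 1 else 0 :: real)" for v p
  define Z where "Z p = (\<Sum>v\<in>W. I v p)" for p
  have sI: "(\<Sum>p\<in>\<Omega>. I u p * I v p) = real (card {p \<in> \<Omega>. P u p \<and> P v p})" for u v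
  proof -
    have "(\<Sum>p\<in>\<Omega>. I u p * I v p) = (\<Sum>p\<in>\<Omega>. if P u p \<and> P v p then 1 else 0)"
      by (intro sum.cong) (auto simp: I_def)
    then show ?thesis using assms(1) by (simp add: sum.If_cases Int_def)
  qed
  have "(\<Sum>p\<in>\<Omega>. I v p) = a" if "v \<in> W" for v
    using a[OF that] sI[of v v] by (simp add: I_def if_distrib cong: if_cong)
  then have Z1: "(\<Sum>p\<in>\<Omega>. Z p) = N * a"
    unfolding Z_def by (subst sum.swap) (simp add: N_def)
  have "(\<Sum>p\<in>\<Omega>. Z p ^ 2) = (\<Sum>u\<in>W. \<Sum>v\<in>W. \<Sum>p\<in>\<Omega>. I u p * I v p)"
    unfolding Z_def power2_eq_square sum_product
    by (subst sum.swap) (intro sum.cong refl, rule sum.swap)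
  also have "\<dots> \<le> (\<Sum>u\<in>W. a + N * b)"
  proof (intro sum_mono)
    fix u assume u: "u \<in> W"
    have "(\<Sum>v\<in>W. \<Sum>p\<in>\<Omega>. I u p * I v p) = a + (\<Sum>v\<in>W - {u}. \<Sum>p\<in>\<Omega>. I u p * I v p)"
      using u assms(3) a[OF u] by (simp add: sum.remove sI)
    also have "\<dots> \<le> a + (\<Sum>v\<in>W - {u}. b)"
      using u b by (intro add_left_mono sum_mono) (auto simp: sI)
    also have "\<dots> \<le> a + N * b"
      using u assms(3) b0 by (auto simp: N_def intro!: mult_right_mono)
    finally show "(\<Sum>v\<in>W. \<Sum>p\<in>\<Omega>. I u p * I v p) \<le> a + N * b" .
  qed
  finally have Z2: "(\<Sum>p\<in>\<Omega>. Z p ^ 2) \<le> N * (a + N * b)"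
    by (simp add: N_def)
  \<comment> \<open>Here \<open>Z p = 0\<close>, so each such \<open>p\<close> contributes exactly
    \<open>(N * a)\<^sup>2\<close>. The deviation of \<open>Z\<close> from its mean
    \<open>N * a / F\<close> is scaled by \<open>F\<close>.\<close>
  have "real (card {p \<in> \<Omega>. \<forall>v\<in>W. \<not> P v p}) * (N * a)\<^sup>2 =
      (\<Sum>p\<in>{p \<in> \<Omega>. \<forall>v\<in>W. \<not> P v p}. (F * Z p - N * a)\<^sup>2)"
    by (simp add: Z_def I_def)
  also have "\<dots> \<le> (\<Sum>p\<in>\<Omega>. (F * Z p - N * a)\<^sup>2)"
    using assms(1) by (intro sum_mono2) auto
  also have "\<dots> = F\<^sup>2 * (\<Sum>p\<in>\<Omega>. Z p ^ 2) - F * (N * a)\<^sup>2"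
  proof -
    have "(\<Sum>p\<in>\<Omega>. (F * Z p - N * a)\<^sup>2) =
      F\<^sup>2 * (\<Sum>p\<in>\<Omega>. Z p ^ 2) - 2 * F * (N * a) * (\<Sum>p\<in>\<Omega>. Z p) + F * (N * a)\<^sup>2"
    proof -
      have "(F * Z p - N * a)\<^sup>2 = F\<^sup>2 * Z p ^ 2 - 2 * F * (N * a) * Z p + (N * a)\<^sup>2" for p
        by (simp add: power2_eq_square algebra_simps)
      then show ?thesis
        by (simp only: sum.distrib sum_subtractf sum_distrib_left[symmetric] sum_constant F_def)
    qed
    then show ?thesis unfolding Z1 by (simp add: power2_eq_square algebra_simps)
  qed
  also have "\<dots> \<le> F\<^sup>2 * (N * (a + N * b)) - F * (N * a)\<^sup>2"
    using Z2 by (simp add: mult_left_mono)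
  finally have "real (card {p \<in> \<Omega>. \<forall>v\<in>W. \<not> P v p}) * (N * a)\<^sup>2 / (F * (N * a)\<^sup>2) \<le>
      (F\<^sup>2 * (N * (a + N * b)) - F * (N * a)\<^sup>2) / (F * (N * a)\<^sup>2)"
    using F N assms(5) by (intro divide_right_mono) auto
  also have "\<dots> = F / (N * a) + F * b / a\<^sup>2 - 1"
    using F N assms(5) by (simp add: field_simps power2_eq_square)
  finally show ?thesis
    using N assms(5) by (simp add: F_def N_def)
qed

text \<open>\<open>m! / (m - d)!\<close> is a product of \<open>d\<close> factors, each larger than
  \<open>m - d\<close>.\<close>

lemma power_le_fact_choose:
  assumes "d \<le> m"
  shows "(m - d) ^ d \<le> fact d * (m choose d)"
proof -
  have *: "fact j * j ^ d \<le> (fact (j + d) :: nat)" for j d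
  proof (induction d)
    case (Suc d)
    have "fact j * j ^ Suc d = j * (fact j * j ^ d)" by simp
    also have "\<dots> \<le> Suc (j + d) * fact (j + d)" using Suc by (intro mult_mono) auto
    finally show ?case by simp
  qed simp
  have "fact (m - d) * (m - d) ^ d \<le> fact (m - d) * (fact d * (m choose d))"
    using *[of "m - d" d] binomial_fact_lemma[OF assms] assms by (simp add: mult_ac)
  then show ?thesis by (simp only: nat_mult_le_cancel_disj) simp
qed

lemma one_add_power_le_exp: "0 \<le> x \<Longrightarrow> (1 + x) ^ n \<le> exp (real n * x)"
  by (metis exp_ge_add_one_self exp_of_nat_mult power_mono add_nonneg_nonneg zero_le_one)

text \<open>Chebyshev's inequality for the number of non-roots with exactly \<open>d\<close>
  children. The first term bounds the reciprocal of its expectation, the second the deviation of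
  pairs from independence. The \<open>1\<close> in the exponent comes from
  \<open>(q / (q - 1)) ^ (m - d) \<le> exp 1\<close>, the rest of the exponent from comparing
  \<open>q ^ d\<close> with \<open>(m - d) ^ d\<close>.\<close>

lemma child_count_avoid:
  assumes "finite V" "R \<subset> V" "R \<noteq> {}"
  defines "m \<equiv> card (V - R) - 1" and "q \<equiv> card V" and "k \<equiv> card R"
  assumes d: "2 * d < m"
  shows "real (card {p \<in> rooted_forests V R. \<forall>v\<in>V - R. child_count V R p v \<noteq> d}) /
      card (rooted_forests V R) \<le>
    exp (1 + d * (k + 1 + d) / (real m - d)) * fact d / (real m + 1) + (exp (2 * d / (real q - 1)) - 1)"
proof -
  define a b where "a = real (k * ((m choose d) * (q - 1) ^ (m - d)))"
    and "b = real (k * ((m choose d) * ((m - d choose d) * (q - 2) ^ (m - d - d))))"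
  have fin: "finite R" "finite (rooted_forests V R)"
    using assms finite_subset finite_rooted_forests by blast+
  have k: "0 < k" using assms fin by (simp add: k_def card_gt_0_iff)
  have qkm: "q = k + m + 1"
    using assms fin d card_mono[of V R] by (auto simp: m_def q_def k_def card_Diff_subset)
  have N: "card (V - R) = m + 1" using d by (simp add: m_def)
  have F: "card (rooted_forests V R) = k * q ^ m"
    using card_rooted_forests[OF assms(1,2)] by (simp add: k_def q_def m_def)
  have q: "2 \<le> q" and md: "d \<le> m" using d qkm k by auto
  then have a0: "0 < a"
    using k by (simp add: a_def)
  have "real (card {p \<in> rooted_forests V R. \<forall>v\<in>V - R. child_count V R p v \<noteq> d}) /
      card (rooted_forests V R) \<le> card (rooted_forests V R) / (card (V - R) * a) +
      card (rooted_forests V R) * b / a\<^sup>2 - 1"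
  proof (rule second_moment_card)
    show "rooted_forests V R \<noteq> {}"
      using F k q fin by (metis card.empty mult_eq_0_iff not_gr_zero power_eq_0_iff zero_less_numeral order_less_le_trans)
    show "real (card {p \<in> rooted_forests V R. child_count V R p v = d}) = a" if "v \<in> V - R" for v
      using card_child_count_eq[OF assms(1,2) that] by (simp add: a_def k_def q_def m_def)
    show "real (card {p \<in> rooted_forests V R. child_count V R p u = d \<and> child_count V R p v = d}) \<le> b"
      if "u \<in> V - R" "v \<in> V - R" "u \<noteq> v" for u v
      using card_child_count_eq2[OF assms(1,2) that] by (simp add: b_def k_def q_def m_def)
  qed (use assms fin a0 in \<open>auto simp: b_def\<close>)
  also have "card (rooted_forests V R) / (card (V - R) * a) \<le>
    exp (1 + d * (k + 1 + d) / (real m - d)) * fact d / (real m + 1)"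
  proof -
    define r where "r = real (m - d)"
    have r: "0 < r" "r = real m - d" using d by (auto simp: r_def)
    define B where "B = real (m choose d)"
    have B: "r ^ d \<le> fact d * B" "0 < B"
      using power_le_fact_choose[OF md] md unfolding r_def B_def
      by (simp_all add: of_nat_le_iff[symmetric, where 'a = real] del: of_nat_le_iff)
    have "card (rooted_forests V R) / (card (V - R) * a) =
      (real q ^ m / (B * (real q - 1) ^ (m - d))) / (real m + 1)"
      using k q by (simp add: F N a_def B_def of_nat_diff mult_ac)
    also have "real q ^ m / (B * (real q - 1) ^ (m - d)) =
      real q ^ d / B * (real q / (real q - 1)) ^ (m - d)"
      using md by (simp add: power_divide power_add[symmetric])
    also have "\<dots> \<le> (fact d * (real q / r) ^ d) * exp 1"
    proof (intro mult_mono)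
      show "real q ^ d / B \<le> fact d * (real q / r) ^ d"
      proof -
        have "real q ^ d * r ^ d \<le> real q ^ d * (fact d * B)"
          using B by (intro mult_left_mono) auto
        then show ?thesis using B(2) r(1) by (simp add: field_simps)
      qed
      have "real q / (real q - 1) = 1 + 1 / (real q - 1)"
        using q by (simp add: field_simps)
      then have "(real q / (real q - 1)) ^ (m - d) \<le> exp (real (m - d) * (1 / (real q - 1)))"
        using q one_add_power_le_exp[of "1 / (real q - 1)" "m - d"] by simp
      also have "\<dots> \<le> exp 1" using q qkm by simp
      finally show "(real q / (real q - 1)) ^ (m - d) \<le> exp 1" .
    qed (use q r in auto)
    also have "(real q / r) ^ d \<le> exp (d * (k + 1 + d) / r)"
    proof -
      have "real q / r = 1 + real (k + 1 + d) / r"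
        using r qkm by (simp add: field_simps)
      then show ?thesis
        using r(1) one_add_power_le_exp[of "real (k + 1 + d) / r" d]
        by (simp add: algebra_simps add_divide_distrib)
    qed
    finally show ?thesis
      by (simp add: r(2) exp_add mult_ac divide_right_mono)
  qed
  also have "card (rooted_forests V R) * b / a\<^sup>2 \<le> exp (2 * d / (real q - 1))"
  proof -
    define B B' where "B = real (m choose d)" and "B' = real (m - d choose d)"
    define l where "l = m - 2 * d"
    have l: "m = l + 2 * d" "m - d - d = l" "m - d = l + d" using d by (auto simp: l_def)
    have B: "0 < B" "0 \<le> B'" "B' \<le> B"
      using md by (auto simp: B_def B'_def intro: binomial_right_mono)
    have "card (rooted_forests V R) * b / a\<^sup>2 =
      real q ^ m * B' * (real q - 2) ^ l / (B * ((real q - 1) ^ (l + d))\<^sup>2)"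
      using k q B(1) unfolding F a_def b_def B_def B'_def l
      by (simp add: power2_eq_square of_nat_diff add.commute mult_ac)
    \<comment> \<open>Pairing \<open>l\<close> factors \<open>q\<close> with the factors
      \<open>q - 2\<close> leaves only quotients of \<open>q * (q - 2)\<close> by
      \<open>(q - 1)\<^sup>2\<close>, which are at most 1. Only the \<open>2 * d\<close> unpaired
      quotients exceed 1.\<close>
    also have "\<dots> = (B' / B) * ((real q * (real q - 2)) ^ l / ((real q - 1)\<^sup>2) ^ l) *
      ((real q / (real q - 1)) ^ (2 * d))"
      unfolding l by (simp add: power_add power_mult_distrib power_divide power_mult[symmetric] mult_ac)
    also have "\<dots> \<le> 1 * 1 * exp (2 * d / (real q - 1))"
    proof (intro mult_mono)
      show "B' / B \<le> 1" using B by simp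
      have "(real q * (real q - 2)) ^ l \<le> ((real q - 1)\<^sup>2) ^ l"
        using q by (intro power_mono) (auto simp: power2_eq_square algebra_simps)
      then show "(real q * (real q - 2)) ^ l / ((real q - 1)\<^sup>2) ^ l \<le> 1"
        using q by (simp add: divide_le_eq_1)
      have "real q / (real q - 1) = 1 + 1 / (real q - 1)"
        using q by (simp add: field_simps)
      then show "(real q / (real q - 1)) ^ (2 * d) \<le> exp (2 * d / (real q - 1))"
        using q one_add_power_le_exp[of "1 / (real q - 1)" "2 * d"] by simp
    qed (use B q in auto)
    finally show ?thesis by simp
  qed
  finally show ?thesis by (simp add: algebra_simps)
qed

section \<open>Complex graphs as cores with attached forests\<close>

definition attach_forest :: "'a set \<Rightarrow> 'a ugraph \<Rightarrow> ('a \<Rightarrow> 'a) \<Rightarrow> 'a ugraph" where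
  "attach_forest V C p = UGraph V (edges C \<union> (\<lambda>v. {v, p v}) ` (V - verts C))"

lemma verts_attach_forest [simp]: "verts (attach_forest V C p) = V"
  and edges_attach_forest:
    "edges (attach_forest V C p) = edges C \<union> (\<lambda>v. {v, p v}) ` (V - verts C)"
  by (simp_all add: attach_forest_def)

section \<open>Cycles, the core, and the forest of a complex graph\<close>

lemma vertex_degree_ge_two:
  assumes "finite (edges G)" "e \<in> edges G" "e' \<in> edges G" "v \<in> e" "v \<in> e'" "e \<noteq> e'"
  shows "2 \<le> vertex_degree G v"
proof -
  have "card {e, e'} \<le> vertex_degree G v"
    unfolding vertex_degree_def using assms by (intro card_mono) auto
  with assms show ?thesis by simp
qed

lemma min_degree_cycle:
  assumes "is_cycle Z"
  shows "min_degree_ge Z 2"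
  unfolding min_degree_ge_def
proof
  obtain vs where vs: "3 \<le> length vs" "distinct vs"
    "Z = UGraph (set vs) {{vs ! i, vs ! (Suc i mod length vs)} | i. i < length vs}"
    using assms by (auto simp: is_cycle_def)
  define l where "l = length vs"
  fix v assume "v \<in> verts Z"
  then obtain i where i: "i < l" "v = vs ! i"
    using vs by (auto simp: in_set_conv_nth l_def)
  \<comment> \<open>The cyclic predecessor of \<open>i\<close>. With at least three vertices it
    differs from the successor, so the two edges at \<open>v\<close> are distinct.\<close>
  define j where "j = (if i = 0 then l - 1 else i - 1)"
  have j: "j < l" "Suc j mod l = i" "j \<noteq> i" "Suc i mod l \<noteq> j" "Suc i mod l < l"
    using i vs(1) by (auto simp: j_def l_def mod_Suc split: if_splits)
  have "{vs ! i, vs ! (Suc i mod l)} \<noteq> {vs ! j, vs ! (Suc j mod l)}"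
    using j i(1) vs(2) by (simp add: doubleton_eq_iff l_def nth_eq_iff_index_eq)
  then show "2 \<le> vertex_degree Z v"
    using i j by (intro vertex_degree_ge_two[of _ "{vs ! i, vs ! (Suc i mod l)}" "{vs ! j, vs ! (Suc j mod l)}"])
      (auto simp: vs(3) l_def[symmetric])
qed

lemma in_component_of_self: "v \<in> verts G \<Longrightarrow> v \<in> verts (component_of G v)"
  by (simp add: component_of_def Let_def)

text \<open>Every component survives, so for complex \<open>H\<close> the maximality in
  \<open>core_of\<close> ranges over the subgraphs of \<open>H\<close> itself.\<close>

lemma complex_part_complex:
  assumes "complex_graph H"
  shows "complex_part H = H"
proof -
  have K: "{K \<in> graph_components H. has_two_cycles K} = component_of H ` verts H"
    using assms by (auto simp: complex_graph_def graph_components_def)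
  have "(\<Union>v\<in>verts H. verts (component_of H v)) = verts H"
    using in_component_of_self by (auto simp: component_of_def Let_def)
  moreover have "e \<in> (\<Union>v\<in>verts H. edges (component_of H v))" if e: "e \<in> edges H" for e
  proof -
    have e2: "e \<subseteq> verts H" "card e = 2"
      using e assms by (auto simp: complex_graph_def simple_graph_def)
    then obtain u w where uw: "e = {u, w}" by (auto simp: card_2_iff)
    then have "(u, w) \<in> adjacency H" using e by (simp add: adjacency_def)
    then have "e \<in> edges (component_of H u)"
      using e e2 uw by (auto simp: component_of_def Let_def)
    then show ?thesis using e2 uw by blast
  qed
  then have "(\<Union>v\<in>verts H. edges (component_of H v)) = edges H"
    by (auto simp: component_of_def Let_def)
  ultimately show ?thesis
    unfolding complex_part_def K by (simp add: ugraph.expand)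
qed

text \<open>Adding a cycle to the core preserves minimum degree two, so maximality forces the cycle
  into the core.\<close>

lemma cycle_subgraph_core:
  assumes "complex_graph H" "core_of C H" "is_cycle Z" "subgraph Z H"
  shows "subgraph Z C"
proof -
  note H = complex_part_complex[OF assms(1)]
  define D where "D = UGraph (verts C \<union> verts Z) (edges C \<union> edges Z)"
  have s: "simple_graph C" "simple_graph Z"
    using assms by (auto simp: core_of_def subgraph_def)
  then have D: "simple_graph D"
    by (auto simp: D_def simple_graph_def)
  have sub: "subgraph C D" "subgraph Z D" "subgraph D (complex_part H)"
    using assms s D by (auto simp: core_of_def subgraph_def D_def H)
  have "2 \<le> vertex_degree D v" if "v \<in> verts D" for v
  proof -
    have "2 \<le> vertex_degree C v \<or> 2 \<le> vertex_degree Z v"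
      using that assms min_degree_cycle[OF assms(3)] by (auto simp: D_def core_of_def min_degree_ge_def)
    then show ?thesis
      using vertex_degree_mono[OF sub(1) D, of v] vertex_degree_mono[OF sub(2) D, of v] by linarith
  qed
  then have "D = C"
    using assms(2) sub by (auto simp: core_of_def min_degree_ge_def)
  then show ?thesis using sub(2) by simp
qed

text \<open>The component of \<open>v\<close> contains a cycle, and that cycle lies in the core.
  Hence the distance to the core, which directs the forest, is finite.\<close>

lemma reaches_core:
  assumes "complex_graph H" "core_of C H" "v \<in> verts H"
  obtains r where "r \<in> verts C" "(v, r) \<in> (adjacency H)\<^sup>*"
proof -
  have "has_two_cycles (component_of H v)"
    using assms by (auto simp: complex_graph_def graph_components_def)
  then obtain Z where Z: "is_cycle Z" "subgraph Z (component_of H v)"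
    by (auto simp: has_two_cycles_def)
  then have "subgraph Z H"
    by (auto simp: subgraph_def component_of_def Let_def)
  then have "subgraph Z C"
    using cycle_subgraph_core assms Z by blast
  moreover obtain r where "r \<in> verts Z"
    using Z(1) by (auto simp: is_cycle_def) (metis list.set_intros(1) list.size(3) neq_Nil_conv not_numeral_le_zero ugraph.sel(1))
  ultimately have "r \<in> verts C" "(v, r) \<in> (adjacency H)\<^sup>*"
    using Z(2) by (auto simp: subgraph_def component_of_def Let_def)
  then show ?thesis by (rule that)
qed

text \<open>Send every vertex outside the core to a neighbour closer to the core. An edge that is neither in
  the core nor of the form \<open>{v, p v}\<close> would enlarge the core, together with the two paths that
  \<open>p\<close> yields from its ends to the core.\<close>

lemma obtain_forest:
  assumes "complex_graph H" "core_of C H"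
  obtains p where "p \<in> rooted_forests (verts H) (verts C)" "H = attach_forest (verts H) C p"
proof -
  note part = complex_part_complex[OF assms(1)]
  define V where "V = verts H"
  have H: "simple_graph H" and C: "subgraph C H" "simple_graph C" "min_degree_ge C 2"
    using assms by (auto simp: complex_graph_def core_of_def part subgraph_def)
  have CV: "verts C \<subseteq> V" using C(1) by (auto simp: subgraph_def V_def)
  define \<delta> where "\<delta> v = (LEAST n. \<exists>r\<in>verts C. (v, r) \<in> adjacency H ^^ n)" for v
  have "\<exists>w. w \<in> V \<and> {v, w} \<in> edges H \<and> \<delta> w < \<delta> v" if v: "v \<in> V - verts C" for v
  proof -
    obtain r where "r \<in> verts C" "(v, r) \<in> (adjacency H)\<^sup>*"
      using v by (auto simp: V_def intro: reaches_core[OF assms])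
    then have "\<exists>n. \<exists>r\<in>verts C. (v, r) \<in> adjacency H ^^ n"
      by (auto simp: rtrancl_power)
    then have "\<exists>r\<in>verts C. (v, r) \<in> adjacency H ^^ \<delta> v"
      unfolding \<delta>_def by (rule LeastI_ex)
    then obtain r where r: "r \<in> verts C" "(v, r) \<in> adjacency H ^^ \<delta> v" by blast
    with v obtain n where n: "\<delta> v = Suc n" by (cases "\<delta> v") auto
    with r obtain w where w: "(v, w) \<in> adjacency H" "(w, r) \<in> adjacency H ^^ n"
      by (metis relpow_Suc_D2)
    have "\<delta> w \<le> n" unfolding \<delta>_def using r w by (intro Least_le) blast
    moreover have "{v, w} \<in> edges H" using w(1) by (simp add: adjacency_def)
    moreover have "w \<in> V" using \<open>{v, w} \<in> edges H\<close> H by (auto simp: simple_graph_def V_def)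
    ultimately show ?thesis using n by auto
  qed
  then obtain p0 where p0: "\<And>v. v \<in> V - verts C \<Longrightarrow> p0 v \<in> V \<and> {v, p0 v} \<in> edges H \<and> \<delta> (p0 v) < \<delta> v"
    by metis
  define p where "p = restrict p0 (V - verts C)"
  have p: "p v \<in> V" "{v, p v} \<in> edges H" "\<delta> (p v) < \<delta> v" if "v \<in> V" "v \<notin> verts C" for v
    using p0 that by (auto simp: p_def)
  have forest: "p \<in> rooted_forests V (verts C)"
    using p by (auto simp: rooted_forests_def p_def intro!: exI[of _ \<delta>])
  define E where "E = (\<lambda>v. {v, p v}) ` (V - verts C)"
  have "edges H \<subseteq> edges C \<union> E"
  proof (rule ccontr)
    assume "\<not> edges H \<subseteq> edges C \<union> E"
    then obtain e where e: "e \<in> edges H" "e \<notin> edges C" "e \<notin> E" by blast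
    then have eV: "e \<subseteq> V" using H by (auto simp: simple_graph_def V_def)
    define P where "P = {(v, p v) | v. v \<in> V - verts C}"
    define S where "S = P\<^sup>* `` e"
    have "x \<in> V" if "(u, x) \<in> P\<^sup>*" "u \<in> e" for u x
      using that eV by (induction) (auto simp: P_def p)
    then have SV: "S \<subseteq> V" by (auto simp: S_def)
    have eS: "e \<subseteq> S" by (auto simp: S_def)
    have pS: "p x \<in> S" if "x \<in> S" "x \<notin> verts C" for x
    proof -
      have "(x, p x) \<in> P" using that SV by (auto simp: P_def)
      then show ?thesis using that by (auto simp: S_def intro: rtrancl_into_rtrancl)
    qed
    define D where "D = UGraph (verts C \<union> S) (edges C \<union> (\<lambda>v. {v, p v}) ` (S - verts C) \<union> {e})"
    have ED: "edges D \<subseteq> edges H"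
      using C(1) SV p e(1) by (auto simp: D_def subgraph_def)
    have "e' \<subseteq> verts D" if "e' \<in> edges D" for e'
      using that eS pS C(2) by (auto simp: D_def simple_graph_def)
    moreover have "card e' = 2" if "e' \<in> edges D" for e'
      using that ED H by (auto simp: simple_graph_def)
    moreover have "finite (verts D)"
      using CV SV H finite_subset[of "verts C \<union> S" V] by (auto simp: simple_graph_def D_def V_def)
    ultimately have "simple_graph D"
      by (auto simp: simple_graph_def)
    then have sub: "subgraph D H" "subgraph C D"
      using ED CV SV C(2) by (auto simp: subgraph_def D_def V_def)
    have fin: "finite (edges D)" using \<open>simple_graph D\<close> by (rule finite_edges)
    \<comment> \<open>Outside the core, \<open>x\<close> has its parent edge and a second one:
      \<open>e\<close> if \<open>x\<close> is an end of \<open>e\<close>, otherwise the last edge of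
      a path from \<open>e\<close> to \<open>x\<close>. As \<open>\<delta>\<close> decreases along
      \<open>p\<close>, the latter is not the parent edge.\<close>
    have "2 \<le> vertex_degree D x" if x: "x \<in> verts D" for x
    proof (cases "x \<in> verts C")
      case True
      then show ?thesis
        using C(3) vertex_degree_mono[OF sub(2) \<open>simple_graph D\<close>, of x]
        by (auto simp: min_degree_ge_def intro: order_trans)
    next
      case False
      then have xS: "x \<in> S" using x by (simp add: D_def)
      have px: "{x, p x} \<in> edges D" using False xS by (auto simp: D_def)
      show ?thesis
      proof (cases "x \<in> e")
        case True
        have "e \<noteq> {x, p x}" using e(3) False xS SV by (auto simp: E_def)
        then show ?thesis
          using True px fin by (intro vertex_degree_ge_two[of D e "{x, p x}"]) (auto simp: D_def)
      next
        case notin: False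
        obtain u where u: "u \<in> e" "(u, x) \<in> P\<^sup>*" using xS by (auto simp: S_def)
        then obtain y where y: "(u, y) \<in> P\<^sup>*" "(y, x) \<in> P"
          using notin by (metis rtranclE)
        have yS: "y \<in> S" "y \<in> V" "y \<notin> verts C" "x = p y"
          using y u by (auto simp: S_def P_def)
        have "y \<noteq> p x"
          using p(3)[of y] p(3)[of x] yS False xS SV by auto
        then have "{y, p y} \<noteq> {x, p x}"
          using p(3)[of y] yS by (auto simp: doubleton_eq_iff)
        then show ?thesis
          using px fin yS by (intro vertex_degree_ge_two[of D "{y, p y}" "{x, p x}"]) (auto simp: D_def)
      qed
    qed
    then have "D = C"
      using assms(2) sub by (auto simp: core_of_def part min_degree_ge_def)
    moreover have "e \<in> edges D" by (simp add: D_def)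
    ultimately show False using e(2) by simp
  qed
  moreover have "edges C \<union> E \<subseteq> edges H"
    using C(1) p by (auto simp: E_def subgraph_def)
  ultimately have "edges H = edges C \<union> E" by (rule equalityI)
  then have "H = attach_forest V C p"
    by (intro ugraph.expand) (simp add: attach_forest_def E_def V_def)
  then show ?thesis
    using that forest by (simp add: V_def)
qed

text \<open>The cycles in the component of \<open>r\<close> in \<open>H\<close> lie in
  \<open>C\<close>, and they stay in one component of \<open>C\<close> because forest edges cannot
  join components of \<open>C\<close>. With this, attaching any other forest to \<open>C\<close>
  yields a complex graph as well.\<close>

lemma component_core_has_two_cycles:
  assumes "complex_graph H" "core_of C H" "r \<in> verts C"
  shows "has_two_cycles (component_of C r)"
proof -
  obtain p where p: "p \<in> rooted_forests (verts H) (verts C)" "H = attach_forest (verts H) C p"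
    using obtain_forest assms by blast
  define V where "V = verts H"
  have C: "simple_graph C" "verts C \<subseteq> V"
    using assms by (auto simp: core_of_def complex_part_complex subgraph_def V_def)
  define P where "P = {(v, p v) | v. v \<in> V - verts C}"
  have end_P: "u = s" if "(u, s) \<in> P\<^sup>*" "u \<in> verts C" for u s
    using that by (auto elim: converse_rtranclE simp: P_def)
  have step_P: "(p u, s) \<in> P\<^sup>*" if "(u, s) \<in> P\<^sup>*" "u \<in> V - verts C" "s \<in> verts C" for u s
    using that by (auto elim: converse_rtranclE simp: P_def)
  \<comment> \<open>Invariant of a walk in \<open>H\<close>: from its current vertex, parents lead
    to a core vertex \<open>s\<close> that \<open>r\<close> reaches inside \<open>C\<close>. A
    forest edge leaves \<open>s\<close> unchanged, a core edge moves it along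
    \<open>C\<close>.\<close>
  have reach: "\<exists>s\<in>verts C. (r, s) \<in> (adjacency C)\<^sup>* \<and> (u, s) \<in> P\<^sup>*" if "(r, u) \<in> (adjacency H)\<^sup>*" for u
    using that
  proof (induction rule: rtrancl_induct)
    case base
    then show ?case using assms(3) by blast
  next
    case (step u u')
    then obtain s where s: "s \<in> verts C" "(r, s) \<in> (adjacency C)\<^sup>*" "(u, s) \<in> P\<^sup>*" by blast
    have "{u, u'} \<in> edges (attach_forest V C p)"
      using step(2) p(2) by (simp add: adjacency_def V_def)
    then consider "{u, u'} \<in> edges C" | v where "v \<in> V - verts C" "{u, u'} = {v, p v}"
      by (auto simp: edges_attach_forest)
    then show ?case
    proof cases
      case 1
      then have "u \<in> verts C" "u' \<in> verts C" "(u, u') \<in> adjacency C"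
        using C by (auto simp: simple_graph_def adjacency_def)
      then show ?thesis
        using s end_P[OF s(3)] by (metis rtrancl.rtrancl_into_rtrancl rtrancl.rtrancl_refl)
    next
      case (2 v)
      then consider "u = v" "u' = p v" | "u' = v" "u = p v"
        by (auto simp: doubleton_eq_iff)
      then show ?thesis
      proof cases
        case 1
        then show ?thesis using step_P s 2(1) by blast
      next
        case b: 2
        then have "(u', u) \<in> P" using 2(1) by (auto simp: P_def)
        then show ?thesis using s by (meson converse_rtrancl_into_rtrancl)
      qed
    qed
  qed
  have sub: "subgraph Z (component_of C r)" if Z: "is_cycle Z" "subgraph Z (component_of H r)" for Z
  proof -
    have "subgraph Z H"
      using Z(2) by (auto simp: subgraph_def component_of_def Let_def)
    then have ZC: "subgraph Z C"
      using cycle_subgraph_core assms Z by blast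
    have "(r, u) \<in> (adjacency C)\<^sup>*" if "u \<in> verts Z" for u
    proof -
      have "(r, u) \<in> (adjacency H)\<^sup>*" "u \<in> verts C"
        using that Z(2) ZC by (auto simp: subgraph_def component_of_def Let_def)
      then show ?thesis using reach end_P by blast
    qed
    then show ?thesis
      using ZC by (fastforce simp: subgraph_def component_of_def Let_def simple_graph_def)
  qed
  have "has_two_cycles (component_of H r)"
    using assms C by (auto simp: complex_graph_def graph_components_def V_def)
  then show ?thesis
    unfolding has_two_cycles_def using sub by blast
qed

section \<open>Attaching a forest to a core\<close>

lemma rooted_forests_rank:
  assumes "p \<in> rooted_forests V R"
  obtains \<delta> :: "'a \<Rightarrow> nat" where "\<And>v. v \<in> V \<Longrightarrow> v \<notin> R \<Longrightarrow> p v \<in> V \<and> \<delta> (p v) < \<delta> v"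
  using assms by (auto simp: rooted_forests_def)

lemma simple_attach_forest:
  assumes "finite V" "simple_graph C" "verts C \<subseteq> V" "p \<in> rooted_forests V (verts C)"
  shows "simple_graph (attach_forest V C p)"
proof -
  obtain \<delta> :: "'a \<Rightarrow> nat" where p: "\<And>v. v \<in> V \<Longrightarrow> v \<notin> verts C \<Longrightarrow> p v \<in> V \<and> \<delta> (p v) < \<delta> v"
    using rooted_forests_rank assms(4) by blast
  have "p v \<noteq> v" if "v \<in> V" "v \<notin> verts C" for v
    using p[OF that] by auto
  then have "card {v, p v} = 2" if "v \<in> V" "v \<notin> verts C" for v
    using that by (metis card_2_iff)
  then show ?thesis
    using assms p unfolding simple_graph_def edges_attach_forest verts_attach_forest by blast
qed

text \<open>Parents lead every vertex to a root, so each component of the new graph contains a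
  component of \<open>C\<close> and inherits its cycles.\<close>

lemma complex_attach_forest:
  assumes "finite V" "simple_graph C" "verts C \<subseteq> V" "p \<in> rooted_forests V (verts C)"
    and "\<And>r. r \<in> verts C \<Longrightarrow> has_two_cycles (component_of C r)"
  shows "complex_graph (attach_forest V C p)"
proof -
  let ?H = "attach_forest V C p"
  obtain \<delta> :: "'a \<Rightarrow> nat" where p: "\<And>v. v \<in> V \<Longrightarrow> v \<notin> verts C \<Longrightarrow> p v \<in> V \<and> \<delta> (p v) < \<delta> v"
    using rooted_forests_rank assms(4) by blast
  have reach: "\<exists>r\<in>verts C. (v, r) \<in> (adjacency ?H)\<^sup>*" if "v \<in> V" for v
    using that
  proof (induction "\<delta> v" arbitrary: v rule: less_induct)
    case less
    show ?case
    proof (cases "v \<in> verts C")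
      case False
      then have "(v, p v) \<in> adjacency ?H"
        using less.prems by (auto simp: adjacency_def edges_attach_forest)
      moreover have "\<exists>r\<in>verts C. (p v, r) \<in> (adjacency ?H)\<^sup>*"
        using less.hyps p False less.prems by blast
      ultimately show ?thesis by (meson converse_rtrancl_into_rtrancl)
    qed blast
  qed
  have CH: "adjacency C \<subseteq> adjacency ?H"
    by (auto simp: adjacency_def edges_attach_forest)
  have "has_two_cycles (component_of ?H v)" if v: "v \<in> V" for v
  proof -
    obtain r where r: "r \<in> verts C" "(v, r) \<in> (adjacency ?H)\<^sup>*" using reach[OF v] by blast
    have "(v, u) \<in> (adjacency ?H)\<^sup>*" if "(r, u) \<in> (adjacency C)\<^sup>*" for u
      using r(2) rtrancl_mono[OF CH] that by (meson rtrancl_trans subsetD)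
    then have W: "{u \<in> verts C. (r, u) \<in> (adjacency C)\<^sup>*} \<subseteq> {u \<in> V. (v, u) \<in> (adjacency ?H)\<^sup>*}"
      using assms(3) by blast
    have "verts (component_of C r) \<subseteq> verts (component_of ?H v)"
      "edges (component_of C r) \<subseteq> edges (component_of ?H v)"
      using W unfolding component_of_def Let_def ugraph.sel verts_attach_forest edges_attach_forest
      by blast+
    then have "subgraph Z (component_of ?H v)" if "subgraph Z (component_of C r)" for Z
      using that by (meson subgraph_def order_trans)
    then show ?thesis
      using assms(5)[OF r(1)] unfolding has_two_cycles_def by blast
  qed
  then show ?thesis
    using simple_attach_forest[OF assms(1-4)] by (auto simp: complex_graph_def graph_components_def)
qed

text \<open>In a subgraph that is not contained in \<open>C\<close>, a vertex outside \<open>C\<close> of maximal rank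
  has no neighbour but its parent.\<close>

lemma core_of_attach_forest:
  assumes "finite V" "simple_graph C" "verts C \<subseteq> V" "p \<in> rooted_forests V (verts C)"
    and "\<And>r. r \<in> verts C \<Longrightarrow> has_two_cycles (component_of C r)" and min: "min_degree_ge C 2"
  shows "core_of C (attach_forest V C p)"
proof -
  let ?H = "attach_forest V C p"
  have part: "complex_part ?H = ?H"
    by (rule complex_part_complex[OF complex_attach_forest[OF assms(1-5)]])
  obtain \<delta> :: "'a \<Rightarrow> nat" where p: "\<And>v. v \<in> V \<Longrightarrow> v \<notin> verts C \<Longrightarrow> p v \<in> V \<and> \<delta> (p v) < \<delta> v"
    using rooted_forests_rank assms(4) by blast
  have CH: "subgraph C ?H"
    using assms by (auto simp: subgraph_def edges_attach_forest)
  have "D = C" if D: "subgraph D ?H" "min_degree_ge D 2" "subgraph C D" for D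
  proof -
    have D': "simple_graph D" "verts D \<subseteq> V" "edges D \<subseteq> edges ?H"
      using D(1) by (auto simp: subgraph_def)
    have "verts D \<subseteq> verts C"
    proof (rule ccontr)
      assume "\<not> verts D \<subseteq> verts C"
      then have ne: "verts D - verts C \<noteq> {}" "finite (verts D - verts C)"
        using D'(1) by (auto simp: simple_graph_def)
      then have "Max (\<delta> ` (verts D - verts C)) \<in> \<delta> ` (verts D - verts C)"
        by (intro Max_in) auto
      then obtain x where x: "x \<in> verts D" "x \<notin> verts C" "Max (\<delta> ` (verts D - verts C)) = \<delta> x"
        by auto
      have max: "\<delta> y \<le> \<delta> x" if "y \<in> verts D - verts C" for y
        using that ne(2) by (auto simp: x(3)[symmetric])
      have "e = {x, p x}" if e: "e \<in> edges D" "x \<in> e" for e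
      proof -
        have "e \<notin> edges C" using x(2) e(2) assms(2) by (auto simp: simple_graph_def)
        then obtain y where y: "y \<in> V" "y \<notin> verts C" "e = {y, p y}"
          using e(1) D'(3) by (auto simp: edges_attach_forest)
        have "y \<in> verts D" using e(1) y(3) D'(1) by (auto simp: simple_graph_def)
        then have "\<delta> y \<le> \<delta> x" using max y(2) by blast
        then have "x \<noteq> p y" using p[OF y(1,2)] by auto
        then show ?thesis using y(3) e(2) by auto
      qed
      then have "{e \<in> edges D. x \<in> e} \<subseteq> {{x, p x}}" by blast
      then have "vertex_degree D x \<le> card {{x, p x}}"
        unfolding vertex_degree_def by (intro card_mono) auto
      then show False
        using D(2) x(1) by (auto simp: min_degree_ge_def)
    qed
    moreover have "verts C \<subseteq> verts D" "edges C \<subseteq> edges D" using D(3) by (auto simp: subgraph_def)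
    moreover have "edges D \<subseteq> edges C"
    proof
      fix e assume e: "e \<in> edges D"
      then have "e \<subseteq> verts C"
        using D'(1) \<open>verts D \<subseteq> verts C\<close> by (auto simp: simple_graph_def)
      then show "e \<in> edges C"
        using e D'(3) by (auto simp: edges_attach_forest)
    qed
    ultimately show ?thesis by (intro ugraph.expand) auto
  qed
  then show ?thesis
    using CH min by (simp add: core_of_def part)
qed

text \<open>Induction on the rank of \<open>p\<close>. If \<open>{v, p v}\<close> were the parent
  edge of \<open>w = p v\<close> under \<open>p'\<close>, then \<open>p' w = v\<close>, hence
  \<open>p w = v\<close> by induction, against the rank.\<close>

lemma inj_on_attach_forest:
  assumes "simple_graph C" "verts C \<subseteq> V"
  shows "inj_on (attach_forest V C) (rooted_forests V (verts C))"
proof (rule inj_onI)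
  fix p p' assume pp: "p \<in> rooted_forests V (verts C)" "p' \<in> rooted_forests V (verts C)"
    and eq: "attach_forest V C p = attach_forest V C p'"
  obtain \<delta> :: "'a \<Rightarrow> nat" where \<delta>: "\<And>v. v \<in> V \<Longrightarrow> v \<notin> verts C \<Longrightarrow> p v \<in> V \<and> \<delta> (p v) < \<delta> v"
    using rooted_forests_rank pp(1) by blast
  have "p v = p' v" if "v \<in> V" "v \<notin> verts C" for v
    using that
  proof (induction "\<delta> v" arbitrary: v rule: less_induct)
    case less
    have "{v, p v} \<in> edges (attach_forest V C p')"
      using less.prems by (simp add: eq[symmetric] edges_attach_forest)
    moreover have "{v, p v} \<notin> edges C"
      using less.prems assms by (auto simp: simple_graph_def)
    ultimately obtain w where w: "w \<in> V" "w \<notin> verts C" "{v, p v} = {w, p' w}"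
      by (auto simp: edges_attach_forest)
    show ?case
    proof (rule ccontr)
      assume "p v \<noteq> p' v"
      then have wv: "w = p v" "p' w = v" using w(3) by (auto simp: doubleton_eq_iff)
      then have "p w = p' w" using less w \<delta> by blast
      then show False using wv \<delta>[OF less.prems] \<delta>[OF w(1,2)] by auto
    qed
  qed
  then show "p = p'"
    using pp by (intro PiE_ext[of p "V - verts C" "\<lambda>_. V" p']) (auto simp: rooted_forests_def)
qed

text \<open>This carries the uniform distribution on forests to the one on complex graphs. One
  member of the class supplies what is needed of \<open>C\<close>: it fits into
  \<open>{1..q}\<close> and its components have two cycles.\<close>

lemma bij_betw_attach_forest:
  assumes "complex_with_core C q \<noteq> {}"
  shows "bij_betw (attach_forest {1..q} C) (rooted_forests {1..q} (verts C)) (complex_with_core C q)"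
proof -
  obtain H where H: "verts H = {1..q}" "complex_graph H" "core_of C H"
    using assms by (auto simp: complex_with_core_def)
  have C: "simple_graph C" "verts C \<subseteq> {1..q}" "min_degree_ge C 2"
    using H by (auto simp: core_of_def complex_part_complex subgraph_def)
  note two = component_core_has_two_cycles[OF H(2,3)]
  have "complex_with_core C q \<subseteq> attach_forest {1..q} C ` rooted_forests {1..q} (verts C)"
  proof
    fix G assume "G \<in> complex_with_core C q"
    then have G: "verts G = {1..q}" "complex_graph G" "core_of C G"
      by (auto simp: complex_with_core_def)
    then show "G \<in> attach_forest {1..q} C ` rooted_forests {1..q} (verts C)"
      using obtain_forest[OF G(2,3)] unfolding G(1) by blast
  qed
  moreover have "attach_forest {1..q} C p \<in> complex_with_core C q"
    if "p \<in> rooted_forests {1..q} (verts C)" for p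
    using complex_attach_forest[OF _ C(1,2) that two] core_of_attach_forest[OF _ C(1,2) that two C(3)]
    by (simp add: complex_with_core_def)
  ultimately show ?thesis
    using inj_on_attach_forest[OF C(1,2)] by (auto simp: bij_betw_def)
qed

section \<open>Degrees in terms of numbers of children\<close>

lemma vertex_degree_attach_forest_le:
  assumes "finite V" "simple_graph C" "verts C \<subseteq> V" "v \<in> V"
  shows "vertex_degree (attach_forest V C p) v \<le>
    child_count V (verts C) p v + (if v \<in> verts C then vertex_degree C v else 1)"
proof -
  let ?K = "(\<lambda>u. {u, p u}) ` {u \<in> V - verts C. p u = v}"
  let ?B = "if v \<in> verts C then {e \<in> edges C. v \<in> e} else {{v, p v}}"
  have "{e \<in> edges (attach_forest V C p). v \<in> e} \<subseteq> ?K \<union> ?B"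
    using assms(2) by (auto simp: edges_attach_forest simple_graph_def)
  then have "vertex_degree (attach_forest V C p) v \<le> card (?K \<union> ?B)"
    unfolding vertex_degree_def using assms finite_edges[OF assms(2)] by (intro card_mono) auto
  also have "\<dots> \<le> card ?K + card ?B" by (rule card_Un_le)
  also have "card ?K \<le> child_count V (verts C) p v"
    unfolding child_count_def using assms by (intro card_image_le) auto
  finally show ?thesis by (auto simp: vertex_degree_def)
qed

text \<open>The parent edge of \<open>v\<close> is not also the edge to a child, since by the rank
  two vertices cannot be each other's parents.\<close>

lemma vertex_degree_attach_forest_ge:
  assumes "finite V" "simple_graph C" "verts C \<subseteq> V" "p \<in> rooted_forests V (verts C)"
    and v: "v \<in> V - verts C"
  shows "child_count V (verts C) p v + 1 \<le> vertex_degree (attach_forest V C p) v"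
proof -
  obtain \<delta> :: "'a \<Rightarrow> nat" where p: "\<And>v. v \<in> V \<Longrightarrow> v \<notin> verts C \<Longrightarrow> p v \<in> V \<and> \<delta> (p v) < \<delta> v"
    using rooted_forests_rank assms(4) by blast
  let ?U = "{u \<in> V - verts C. p u = v}"
  let ?K = "(\<lambda>u. {u, p u}) ` ?U"
  have "card ?K = child_count V (verts C) p v"
    unfolding child_count_def by (intro card_image inj_onI) (auto simp: doubleton_eq_iff)
  moreover have "{v, p v} \<notin> ?K"
  proof
    assume "{v, p v} \<in> ?K"
    then obtain u where u: "u \<in> V" "u \<notin> verts C" "p u = v" "{v, p v} = {u, v}" by auto
    have "\<delta> (p v) < \<delta> v" "\<delta> v < \<delta> u" using p u v by blast+
    with u(4) show False by (auto simp: doubleton_eq_iff)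
  qed
  ultimately have "child_count V (verts C) p v + 1 = card (insert {v, p v} ?K)"
    using assms(1) by simp
  also have "\<dots> \<le> vertex_degree (attach_forest V C p) v"
    unfolding vertex_degree_def
    using v finite_edges[OF simple_attach_forest[OF assms(1-4)]]
    by (intro card_mono) (auto simp: edges_attach_forest)
  finally show ?thesis .
qed

section \<open>Stirling bounds and the function \<open>\<mu>\<close>\<close>

text \<open>The logarithm of Stirling's approximation of \<open>y!\<close> without the constant
  \<open>ln (2 * pi) / 2\<close>; the equation defining \<open>\<mu> x\<close> says that it takes
  the value \<open>ln x\<close> there.\<close>

definition log_stirling :: "real \<Rightarrow> real" where
  "log_stirling y = (y + 1 / 2) * ln y - y"

text \<open>Mean value theorem: the slope at \<open>z \<ge> x\<close> is
  \<open>ln z + 1 / (2 * z)\<close>, which is at least \<open>ln x\<close>.\<close>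

lemma log_stirling_diff_ge:
  assumes "1 \<le> x" "x \<le> y"
  shows "(y - x) * ln x \<le> log_stirling y - log_stirling x"
proof (cases "x = y")
  case False
  have der: "(log_stirling has_real_derivative (ln z + 1 / (2 * z))) (at z)" if "0 < z" for z
    unfolding log_stirling_def [abs_def] using that
    by (auto intro!: derivative_eq_intros simp: field_simps)
  obtain z where z: "x < z" "z < y" "log_stirling y - log_stirling x = (y - x) * (ln z + 1 / (2 * z))"
    using False assms MVT2[of x y log_stirling "\<lambda>z. ln z + 1 / (2 * z)"] der by auto
  have "ln x \<le> ln z + 1 / (2 * z)"
    using z assms by (intro add_increasing2) auto
  then show ?thesis
    using z assms by (auto intro: mult_left_mono)
qed simp

text \<open>\<open>ln (real (Suc n))\<close> is the increment of \<open>ln (fact n)\<close>, so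
  bounds on the remaining bracket compare the two functions.\<close>

lemma log_stirling_Suc:
  "log_stirling (real (Suc n)) - log_stirling (real n) =
     ln (real (Suc n)) + ((real n + 1 / 2) * (ln (real (Suc n)) - ln (real n)) - 1)"
  by (simp add: log_stirling_def algebra_simps)

text \<open>The bracket is nonnegative since \<open>ln (n + 1) - ln n\<close> is at least
  \<open>2 / (2 * n + 1)\<close>. The constant 1 gives equality at \<open>n = 1\<close>.\<close>

lemma ln_fact_le:
  assumes "1 \<le> n"
  shows "ln (fact n) \<le> 1 + log_stirling (real n)"
  using assms
proof (induction n rule: nat_induct_at_least)
  case base
  show ?case by (simp add: log_stirling_def)
next
  case (Suc n)
  have "2 * (real (Suc n) - real n) / (real n + real (Suc n)) \<le> ln (real (Suc n)) - ln (real n)"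
    using Suc.hyps by (intro ln_inverse_approx_ge) auto
  then have "1 \<le> (real n + 1 / 2) * (ln (real (Suc n)) - ln (real n))"
    using Suc.hyps by (simp add: field_simps)
  moreover have "ln (fact (Suc n) :: real) = ln (real (Suc n)) + ln (fact n)"
    by (simp add: ln_mult)
  ultimately show ?case
    using Suc.IH log_stirling_Suc[of n] by linarith
qed

lemma ln_fact_ge:
  assumes "1 \<le> n"
  shows "log_stirling (real n) \<le> ln (fact n)"
proof -
  \<comment> \<open>The bracket is at most \<open>1 / (4 * n) - 1 / (4 * (n + 1))\<close>, which
    telescopes when \<open>1 / (4 * n)\<close> is carried along; \<open>3 / 4\<close> then gives
    equality at \<open>n = 1\<close>.\<close>
  have "log_stirling (real n) + 3 / 4 + 1 / (4 * real n) \<le> ln (fact n)"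
    using assms
  proof (induction n rule: nat_induct_at_least)
    case base
    show ?case by (simp add: log_stirling_def)
  next
    case (Suc n)
    have "ln (real n + 1) - ln (real n) \<le> 1 * (inverse (real n) + inverse (real n + 1)) / 2"
      using Suc.hyps by (intro ln_inverse_approx_le) auto
    then have "(real n + 1 / 2) * (ln (real (Suc n)) - ln (real n)) \<le>
        (real n + 1 / 2) * ((inverse (real n) + inverse (real n + 1)) / 2)"
      by (intro mult_left_mono) (auto simp: add.commute)
    also have "\<dots> = 1 + 1 / (4 * real n) - 1 / (4 * real (Suc n))"
      using Suc.hyps by (simp add: divide_simps) (simp add: algebra_simps)
    finally have "(real n + 1 / 2) * (ln (real (Suc n)) - ln (real n)) \<le>
        1 + 1 / (4 * real n) - 1 / (4 * real (Suc n))" .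
    moreover have "ln (fact (Suc n) :: real) = ln (real (Suc n)) + ln (fact n)"
      by (simp add: ln_mult)
    ultimately show ?case
      using Suc.IH log_stirling_Suc[of n] by linarith
  qed
  moreover have "0 \<le> 1 / (4 * real n)" by simp
  ultimately show ?thesis by linarith
qed

lemma
  assumes "0 < x"
  shows \<mu>_pos: "0 < \<mu> x" and log_stirling_\<mu>: "log_stirling (\<mu> x) = ln x"
  using theI'[OF \<mu>_exists_unique[OF assms]] by (auto simp: \<mu>_def log_stirling_def)

text \<open>Values \<open>\<mu> x < B\<close> would bound \<open>ln x\<close>, because
  \<open>log_stirling\<close> increases on \<open>[1, B]\<close> and is negative on
  \<open>(0, 1)\<close>.\<close>

lemma \<mu>_at_top: "filterlim \<mu> at_top at_top"
  unfolding filterlim_at_top_gt[of _ _ 1]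
proof (intro allI impI)
  fix B :: real assume B: "1 < B"
  have "eventually (\<lambda>x::real. max 0 (log_stirling B) < ln x) at_top"
    using ln_at_top by (simp only: filterlim_at_top_dense)
  then show "eventually (\<lambda>x. B \<le> \<mu> x) at_top"
    using eventually_gt_at_top[of 0]
  proof eventually_elim
    case (elim x)
    show ?case
    proof (rule ccontr)
      assume lt: "\<not> B \<le> \<mu> x"
      have "log_stirling (\<mu> x) \<le> max 0 (log_stirling B)"
      proof (cases "1 \<le> \<mu> x")
        case True
        then have "0 \<le> (B - \<mu> x) * ln (\<mu> x)" using lt by simp
        then show ?thesis
          using log_stirling_diff_ge[of "\<mu> x" B] True lt by linarith
      next
        case False
        then have "(\<mu> x + 1 / 2) * ln (\<mu> x) \<le> 0"
          using \<mu>_pos[OF elim(2)] by (intro mult_nonneg_nonpos) auto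
        then show ?thesis
          using \<mu>_pos[OF elim(2)] by (simp add: log_stirling_def)
      qed
      then show False using elim log_stirling_\<mu>[OF elim(2)] by simp
    qed
  qed
qed

text \<open>The threshold means \<open>ln (\<mu> x) \<ge> 2\<close>, so
  \<open>log_stirling (\<mu> x)\<close> is at least \<open>2 * \<mu> x - \<mu> x\<close>. This
  converts negative powers of \<open>q\<close> into exponentials in \<open>\<mu> q\<close>.\<close>

lemma exp_\<mu>_le:
  assumes "0 < x" "exp 2 \<le> \<mu> x"
  shows "exp (\<mu> x) \<le> x"
proof -
  have "2 \<le> ln (\<mu> x)" using assms \<mu>_pos[OF assms(1)] by (simp add: ln_ge_iff)
  then have "\<mu> x * 2 \<le> (\<mu> x + 1 / 2) * ln (\<mu> x)"
    using \<mu>_pos[OF assms(1)] by (intro mult_mono) auto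
  then have "\<mu> x \<le> ln x"
    using log_stirling_\<mu>[OF assms(1)] by (simp add: log_stirling_def)
  then show ?thesis using assms(1) by (simp add: ln_ge_iff)
qed

text \<open>To the right of \<open>\<mu> x\<close> the slope of \<open>log_stirling\<close> is at
  least \<open>ln (\<mu> x)\<close>, and \<open>ln_fact_ge\<close> passes to the factorial.\<close>

lemma divide_fact_le:
  assumes "0 < x" "1 \<le> \<mu> x" "\<mu> x + \<epsilon> \<le> real D" "0 \<le> \<epsilon>"
  shows "x / fact D \<le> \<mu> x powr - \<epsilon>"
proof -
  have "1 \<le> D" using assms by linarith
  have "\<epsilon> * ln (\<mu> x) \<le> (real D - \<mu> x) * ln (\<mu> x)"
    using assms by (intro mult_right_mono) auto
  also have "\<dots> \<le> log_stirling D - log_stirling (\<mu> x)"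
    using assms by (intro log_stirling_diff_ge) auto
  also have "\<dots> \<le> ln (fact D) - ln x"
    using ln_fact_ge[OF \<open>1 \<le> D\<close>] log_stirling_\<mu>[OF assms(1)] by simp
  finally have "ln x - ln (fact D) \<le> - \<epsilon> * ln (\<mu> x)" by simp
  then have "exp (ln x - ln (fact D)) \<le> exp (- \<epsilon> * ln (\<mu> x))" by (simp only: exp_le_cancel_iff)
  then show ?thesis
    using assms by (simp add: powr_def exp_diff)
qed

text \<open>The counterpart to the left of \<open>\<mu> x\<close>, where the slope is at least
  \<open>ln d\<close>; the \<open>1\<close> is the loss in \<open>ln_fact_le\<close>.\<close>

lemma fact_divide_le:
  assumes "0 < x" "1 \<le> d" "real d + \<epsilon> \<le> \<mu> x" "0 \<le> \<epsilon>"
  shows "fact d / x \<le> exp (1 - \<epsilon> * ln (real d))"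
proof -
  have "\<epsilon> * ln d \<le> (\<mu> x - real d) * ln d"
    using assms by (intro mult_right_mono) auto
  also have "\<dots> \<le> log_stirling (\<mu> x) - log_stirling d"
    using assms by (intro log_stirling_diff_ge) auto
  also have "\<dots> \<le> ln x - ln (fact d) + 1"
    using ln_fact_le[OF assms(2)] log_stirling_\<mu>[OF assms(1)] by simp
  finally have "ln (fact d) - ln x \<le> 1 - \<epsilon> * ln d" by simp
  then have "exp (ln (fact d) - ln x) \<le> exp (1 - \<epsilon> * ln d)" by (simp only: exp_le_cancel_iff)
  then show ?thesis
    using assms by (simp add: exp_diff)
qed

lemma inverse_fact_le: "0 < a \<Longrightarrow> a \<le> real n \<Longrightarrow> 1 / fact n \<le> 1 / a"
  using fact_ge_self[of n]
  by (intro divide_left_mono mult_pos_pos)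
     (auto simp: of_nat_le_iff[symmetric, where 'a = real] simp del: of_nat_le_iff)

section \<open>The maximum degree of a random complex graph\<close>

lemma verts_core_subset:
  assumes "complex_with_core C q \<noteq> {}"
  shows "simple_graph C" "verts C \<subseteq> {1..q}" "0 < q \<Longrightarrow> verts C \<noteq> {}"
proof -
  obtain H where H: "verts H = {1..q}" "complex_graph H" "core_of C H"
    using assms by (auto simp: complex_with_core_def)
  show "simple_graph C" "verts C \<subseteq> {1..q}"
    using H by (auto simp: core_of_def complex_part_complex subgraph_def)
  show "verts C \<noteq> {}" if "0 < q"
  proof -
    have "1 \<in> verts H" using that H(1) by simp
    then obtain r where "r \<in> verts C" by (rule reaches_core[OF H(2,3)])
    then show ?thesis by blast
  qed
qed

lemma prob_complex_with_core:
  assumes "complex_with_core C q \<noteq> {}"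
  shows "1 - measure_pmf.prob (pmf_of_set (complex_with_core C q)) E =
    real (card {p \<in> rooted_forests {1..q} (verts C). attach_forest {1..q} C p \<notin> E}) /
    real (card (rooted_forests {1..q} (verts C)))"
proof -
  let ?F = "rooted_forests {1..q} (verts C)" and ?f = "attach_forest {1..q} C"
  let ?Q = "complex_with_core C q"
  note bij = bij_betw_attach_forest[OF assms]
  have "1 - measure_pmf.prob (pmf_of_set ?Q) E = measure_pmf.prob (pmf_of_set ?Q) (- E)"
    using measure_pmf.prob_compl[of E "pmf_of_set ?Q"] by (simp add: Compl_eq_Diff_UNIV)
  also have "\<dots> = real (card (?Q \<inter> - E)) / real (card ?Q)"
    using assms finite_complex_with_core by (simp add: measure_pmf_of_set)
  also have "?Q \<inter> - E = ?f ` {p \<in> ?F. ?f p \<notin> E}"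
    using bij by (auto simp: bij_betw_def)
  also have "card \<dots> = card {p \<in> ?F. ?f p \<notin> E}"
    using bij by (intro card_image) (auto simp: bij_betw_def intro: inj_on_subset)
  also have "card ?Q = card ?F"
    using bij_betw_same_card[OF bij] by simp
  finally show ?thesis .
qed

lemma prob_complex_with_core_le:
  assumes "complex_with_core C q \<noteq> {}"
    and "\<And>p. p \<in> rooted_forests {1..q} (verts C) \<Longrightarrow> attach_forest {1..q} C p \<notin> E \<Longrightarrow> P p"
    and "real (card {p \<in> rooted_forests {1..q} (verts C). P p}) \<le>
      real (card (rooted_forests {1..q} (verts C))) * b"
  shows "1 - measure_pmf.prob (pmf_of_set (complex_with_core C q)) E \<le> b"
proof -
  let ?F = "rooted_forests {1..q} (verts C)"
  have fin: "finite ?F" by (rule finite_rooted_forests) simp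
  have "?F \<noteq> {}"
    using bij_betw_attach_forest[OF assms(1)] assms(1) by (auto simp: bij_betw_def)
  then have F: "0 < real (card ?F)" using fin by (simp add: card_gt_0_iff)
  have "real (card {p \<in> ?F. attach_forest {1..q} C p \<notin> E}) \<le> real (card {p \<in> ?F. P p})"
    using assms(2) fin by (auto intro!: card_mono)
  also note assms(3)
  finally show ?thesis
    unfolding prob_complex_with_core[OF assms(1)] using F by (simp add: field_simps)
qed

lemma max_degree_le_iff:
  "finite (verts G) \<Longrightarrow> max_degree G \<le> d \<longleftrightarrow> (\<forall>v\<in>verts G. vertex_degree G v \<le> d)"
  by (simp add: max_degree_def)

lemma vertex_degree_le_max_degree:
  "finite (verts G) \<Longrightarrow> v \<in> verts G \<Longrightarrow> vertex_degree G v \<le> max_degree G"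
  by (simp add: max_degree_def)

text \<open>At every vertex at most \<open>M\<close> edges do not lead to children: the core edges
  of a root, or the one parent edge, covered by \<open>1 \<le> M\<close>.\<close>

lemma prob_max_degree_le:
  assumes "complex_with_core C q \<noteq> {}" "0 < q" "max_degree C \<le> M" "1 \<le> M"
  shows "1 - measure_pmf.prob (pmf_of_set (complex_with_core C q)) {Q. max_degree Q \<le> M + e} \<le>
    real q / fact (Suc e) + 1 / fact e"
proof (rule prob_complex_with_core_le[OF assms(1)])
  let ?V = "{1..q}" and ?R = "verts C"
  note C = verts_core_subset[OF assms(1)]
  have fin: "finite ?R" using C(1) by (simp add: simple_graph_def)
  show "\<exists>v\<in>?V. Suc e \<le> child_count ?V ?R p v"
    if "attach_forest ?V C p \<notin> {Q. max_degree Q \<le> M + e}" for p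
  proof -
    obtain v where v: "v \<in> ?V" "M + e < vertex_degree (attach_forest ?V C p) v"
      using \<open>attach_forest ?V C p \<notin> _\<close> by (auto simp: max_degree_le_iff not_le)
    have "vertex_degree C v \<le> M" if "v \<in> ?R"
      using vertex_degree_le_max_degree[OF fin that] assms(3) by simp
    then show ?thesis
      using v vertex_degree_attach_forest_le[OF _ C(1,2) v(1), of p] assms(4)
      by (intro bexI[of _ v]) (auto split: if_splits)
  qed
  show "real (card {p \<in> rooted_forests ?V ?R. \<exists>v\<in>?V. Suc e \<le> child_count ?V ?R p v}) \<le>
    real (card (rooted_forests ?V ?R)) * (real q / fact (Suc e) + 1 / fact e)"
    using child_count_max_tail[of ?V ?R ?V e] C assms(2) by simp
qed

text \<open>The root degrees exceed the numbers of children by up to \<open>M\<close> rather than by \<open>1\<close>, which is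
  harmless as long as there are only few roots.\<close>

lemma prob_max_degree_le_few_roots:
  assumes "complex_with_core C q \<noteq> {}" "0 < q" "max_degree C \<le> M" "M \<le> e"
  shows "1 - measure_pmf.prob (pmf_of_set (complex_with_core C q)) {Q. max_degree Q \<le> Suc e} \<le>
    (real q / fact (Suc e) + 1 / fact e) +
    (real (card (verts C)) / fact (Suc (e - M)) + 1 / fact (e - M))"
proof (rule prob_complex_with_core_le[OF assms(1)])
  let ?V = "{1..q}" and ?R = "verts C" and ?F = "rooted_forests {1..q} (verts C)"
  let ?A = "\<lambda>p. \<exists>v\<in>?V. Suc e \<le> child_count ?V ?R p v"
  let ?B = "\<lambda>p. \<exists>v\<in>?R. Suc (e - M) \<le> child_count ?V ?R p v"
  note C = verts_core_subset[OF assms(1)]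
  have fin: "finite ?R" using C(1) by (simp add: simple_graph_def)
  show "?A p \<or> ?B p" if "attach_forest ?V C p \<notin> {Q. max_degree Q \<le> Suc e}" for p
  proof -
    obtain v where v: "v \<in> ?V" "Suc e < vertex_degree (attach_forest ?V C p) v"
      using \<open>attach_forest ?V C p \<notin> _\<close> by (auto simp: max_degree_le_iff not_le)
    note le = vertex_degree_attach_forest_le[OF _ C(1,2) v(1), of p]
    show ?thesis
    proof (cases "v \<in> ?R")
      case True
      then have "vertex_degree C v \<le> M"
        using vertex_degree_le_max_degree[OF fin] assms(3) by (meson order_trans)
      then have "Suc (e - M) \<le> child_count ?V ?R p v"
        using le v(2) True assms(4) by simp
      then show ?thesis using True by blast
    next
      case False
      then have "Suc e \<le> child_count ?V ?R p v" using le v(2) by simp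
      then show ?thesis using v(1) by blast
    qed
  qed
  have "{p \<in> ?F. ?A p \<or> ?B p} = {p \<in> ?F. ?A p} \<union> {p \<in> ?F. ?B p}" by blast
  then have "card {p \<in> ?F. ?A p \<or> ?B p} \<le> card {p \<in> ?F. ?A p} + card {p \<in> ?F. ?B p}"
    by (metis (no_types, lifting) card_Un_le)
  then have "real (card {p \<in> ?F. ?A p \<or> ?B p}) \<le> real (card {p \<in> ?F. ?A p}) + real (card {p \<in> ?F. ?B p})"
    by (simp only: of_nat_add[symmetric] of_nat_le_iff)
  also have "\<dots> \<le> real (card ?F) * (real q / fact (Suc e) + 1 / fact e) +
    real (card ?F) * (real (card ?R) / fact (Suc (e - M)) + 1 / fact (e - M))"
    using child_count_max_tail[of ?V ?R ?V e] child_count_max_tail[of ?V ?R ?R "e - M"] C assms(2)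
    by (intro add_mono) auto
  finally show "real (card {p \<in> ?F. ?A p \<or> ?B p}) \<le> real (card ?F) *
     ((real q / fact (Suc e) + 1 / fact e) +
      (real (card (verts C)) / fact (Suc (e - M)) + 1 / fact (e - M)))"
    by (simp only: distrib_left)
qed

text \<open>The parent edge raises \<open>d\<close> children to degree \<open>Suc d\<close>. The
  condition on \<open>d\<close> is the earlier \<open>2 * d < m\<close> with
  \<open>m = q - k - 1\<close>.\<close>

lemma prob_max_degree_ge:
  assumes "complex_with_core C q \<noteq> {}"
  defines "k \<equiv> card (verts C)"
  assumes d: "2 * d + k + 1 < q"
  shows "1 - measure_pmf.prob (pmf_of_set (complex_with_core C q)) {Q. Suc d \<le> max_degree Q} \<le>
    exp (1 + real d * (real k + 1 + real d) / (real q - real k - 1 - real d)) *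
      fact d / (real q - real k) + (exp (2 * real d / (real q - 1)) - 1)"
    (is "_ \<le> ?b")
proof (rule prob_complex_with_core_le[OF assms(1)])
  let ?V = "{1..q}" and ?R = "verts C" and ?F = "rooted_forests {1..q} (verts C)"
  note C = verts_core_subset[OF assms(1)]
  have fin: "finite ?R" using C(1) by (simp add: simple_graph_def)
  have finF: "finite ?F" by (rule finite_rooted_forests) simp
  show "\<forall>v\<in>?V - ?R. child_count ?V ?R p v \<noteq> d"
    if p: "p \<in> ?F" "attach_forest ?V C p \<notin> {Q. Suc d \<le> max_degree Q}" for p
  proof (intro ballI notI)
    fix v assume v: "v \<in> ?V - ?R" "child_count ?V ?R p v = d"
    have "Suc d \<le> vertex_degree (attach_forest ?V C p) v"
      using vertex_degree_attach_forest_ge[OF _ C(1,2) p(1) v(1)] v(2) by simp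
    also have "\<dots> \<le> max_degree (attach_forest ?V C p)"
      using v(1) by (intro vertex_degree_le_max_degree) auto
    finally show False using p(2) by simp
  qed
  have cardVR: "card (?V - ?R) = q - k"
    using C fin by (simp add: card_Diff_subset k_def)
  have R: "?R \<subset> ?V" "?R \<noteq> {}"
    using C d by (auto simp: k_def)
  have "real (card {p \<in> ?F. \<forall>v\<in>?V - ?R. child_count ?V ?R p v \<noteq> d}) / real (card ?F) \<le>
    exp (1 + real d * (real (card ?R) + 1 + real d) / (real (card (?V - ?R) - 1) - real d)) * fact d /
      (real (card (?V - ?R) - 1) + 1) + (exp (2 * real d / (real (card ?V) - 1)) - 1)"
    using d cardVR by (intro child_count_avoid R) auto
  also have "\<dots> = ?b"
    using d unfolding cardVR by (simp add: k_def[symmetric] of_nat_diff algebra_simps)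
  finally have "real (card {p \<in> ?F. \<forall>v\<in>?V - ?R. child_count ?V ?R p v \<noteq> d}) / real (card ?F) \<le> ?b" .
  moreover have "0 < real (card ?F)"
    using bij_betw_attach_forest[OF assms(1)] assms(1) finF by (auto simp: bij_betw_def card_gt_0_iff)
  ultimately show "real (card {p \<in> ?F. \<forall>v\<in>?V - ?R. child_count ?V ?R p v \<noteq> d}) \<le> real (card ?F) * ?b"
    by (simp add: divide_le_eq mult.commute)
qed

section \<open>Passage to the limit\<close>

lemma prob_tendsto_1:
  assumes "eventually (\<lambda>n. 1 - measure_pmf.prob (D n) (E n) \<le> f n) sequentially" "f \<longlonglongrightarrow> 0"
  shows "(\<lambda>n. measure_pmf.prob (D n) (E n)) \<longlonglongrightarrow> 1"
proof (rule tendsto_sandwich)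
  show "(\<lambda>n. 1 - f n) \<longlonglongrightarrow> 1" using tendsto_diff[OF tendsto_const assms(2), of 1] by simp
  show "eventually (\<lambda>n. 1 - f n \<le> measure_pmf.prob (D n) (E n)) sequentially"
    using assms(1) by eventually_elim linarith
qed auto

lemma prob_Int_tendsto_1:
  assumes "(\<lambda>n. measure_pmf.prob (D n) (A n)) \<longlonglongrightarrow> 1" "(\<lambda>n. measure_pmf.prob (D n) (B n)) \<longlonglongrightarrow> 1"
  shows "(\<lambda>n. measure_pmf.prob (D n) (A n \<inter> B n)) \<longlonglongrightarrow> 1"
proof (rule prob_tendsto_1)
  show "(\<lambda>n. (1 - measure_pmf.prob (D n) (A n)) + (1 - measure_pmf.prob (D n) (B n))) \<longlonglongrightarrow> 0"
    using tendsto_add[OF tendsto_diff[OF tendsto_const assms(1), of 1] tendsto_diff[OF tendsto_const assms(2), of 1]]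
    by simp
  have "1 - measure_pmf.prob (D n) (A n \<inter> B n) \<le>
    (1 - measure_pmf.prob (D n) (A n)) + (1 - measure_pmf.prob (D n) (B n))" for n
  proof -
    have c: "1 - measure_pmf.prob (D n) X = measure_pmf.prob (D n) (- X)" for X
      using measure_pmf.prob_compl[of X "D n"] by (simp add: Compl_eq_Diff_UNIV)
    show ?thesis
      unfolding c Compl_Int by (rule measure_Un_le) auto
  qed
  then show "eventually (\<lambda>n. 1 - measure_pmf.prob (D n) (A n \<inter> B n) \<le>
    (1 - measure_pmf.prob (D n) (A n)) + (1 - measure_pmf.prob (D n) (B n))) sequentially"
    by simp
qed

text \<open>The price of lowering a threshold by \<open>M\<close>: each of the \<open>M\<close>
  factors lost is at most \<open>n\<close>.\<close>

lemma fact_le_fact_diff_power: "M \<le> n \<Longrightarrow> fact n \<le> fact (n - M) * real n ^ M"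
proof (induction M)
  case (Suc M)
  then have "n - M = Suc (n - Suc M)" by simp
  then have "fact (n - M) = real (n - M) * fact (n - Suc M)" by (metis fact_Suc of_nat_id)
  also have "\<dots> \<le> real n * fact (n - Suc M)" by (intro mult_right_mono) auto
  finally have "fact (n - M) * real n ^ M \<le> (real n * fact (n - Suc M)) * real n ^ M"
    by (intro mult_right_mono) auto
  then have "fact n \<le> (real n * fact (n - Suc M)) * real n ^ M"
    using Suc by (intro order_trans[OF Suc.IH]) auto
  then show ?case by (simp add: mult_ac)
qed simp

theorem theorem6p4:
  fixes C :: "nat \<Rightarrow> nat ugraph" and q :: "nat \<Rightarrow> nat" and \<epsilon> :: real
  assumes core: "\<And>n. is_core (C n)"
    and verts_C: "\<And>n. verts (C n) = {1..card (verts (C n))}"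
    and nonempty: "\<And>n. complex_with_core (C n) (q n) \<noteq> {}"
    and q_at_top: "filterlim q at_top sequentially"
    and eps: "0 < \<epsilon>"
    and Delta_C: "(\<lambda>n. real (max_degree (C n))) \<in> \<Theta>(\<lambda>_. 1)"
  shows
    "(\<exists>K::real. (\<lambda>n. measure_pmf.prob (pmf_of_set (complex_with_core (C n) (q n)))
         {Q. real (max_degree Q) \<le> \<mu> (real (q n)) + K}) \<longlonglongrightarrow> 1) \<and>
     (\<forall>\<beta>>0. (\<lambda>n. real (card (verts (C n)))) \<in> O(\<lambda>n. real (q n) powr (1 - \<beta>)) \<longrightarrow>
       (\<lambda>n. measure_pmf.prob (pmf_of_set (complex_with_core (C n) (q n)))
         {Q. \<lfloor>\<mu> (real (q n)) - \<epsilon>\<rfloor> + 1 \<le> int (max_degree Q) \<and>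
             int (max_degree Q) \<le> \<lfloor>\<mu> (real (q n)) + \<epsilon>\<rfloor> + 1}) \<longlonglongrightarrow> 1)"
proof -
  define y where "y n = \<mu> (real (q n))" for n
  define k where "k n = card (verts (C n))" for n
  let ?P = "\<lambda>n. measure_pmf.prob (pmf_of_set (complex_with_core (C n) (q n)))"
  have y_top: "filterlim y at_top sequentially"
    unfolding y_def
    by (rule filterlim_compose[OF \<mu>_at_top filterlim_compose[OF filterlim_real_sequentially q_at_top]])
  have q_pos: "eventually (\<lambda>n. 0 < q n) sequentially"
    using eventually_gt_at_top[of 0] q_at_top by (rule eventually_compose_filterlim)
  have y_ge: "eventually (\<lambda>n. B \<le> y n) sequentially" for B
    using y_top by (simp add: filterlim_at_top)
  obtain M where M: "1 \<le> M" "eventually (\<lambda>n. max_degree (C n) \<le> M) sequentially"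
  proof -
    obtain c where c: "eventually (\<lambda>n. norm (real (max_degree (C n))) \<le> c * norm (1 :: real)) sequentially"
      using bigthetaD1[OF Delta_C] by (auto elim!: landau_o.bigE)
    have "eventually (\<lambda>n. max_degree (C n) \<le> max 1 (nat \<lceil>c\<rceil>)) sequentially"
      using c by eventually_elim (simp, linarith)
    then show ?thesis by (intro that[of "max 1 (nat \<lceil>c\<rceil>)"]) auto
  qed
  \<comment> \<open>All error terms below are bounded by functions of \<open>y n\<close> alone, so
    their limits are taken in one real variable.\<close>
  have lim: "(\<lambda>n. f (y n)) \<longlonglongrightarrow> l" if "(f \<longlongrightarrow> l) at_top" for f :: "real \<Rightarrow> real" and l
    using that y_top by (rule filterlim_compose)

  have "(\<lambda>n. ?P n {Q. real (max_degree Q) \<le> y n + real (M + 1)}) \<longlonglongrightarrow> 1"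
  proof (rule prob_tendsto_1)
    show "(\<lambda>n. y n powr - 1 + 1 / y n) \<longlonglongrightarrow> 0"
      by (rule lim) real_asymp
    show "eventually (\<lambda>n. 1 - ?P n {Q. real (max_degree Q) \<le> y n + real (M + 1)} \<le>
      y n powr - 1 + 1 / y n) sequentially"
      using q_pos y_ge[of 1] M(2)
    proof eventually_elim
      case (elim n)
      \<comment> \<open>Then \<open>Suc e\<close> is at least one above \<open>\<mu> (q n)\<close>,
        so the expected number of large vertices is at most \<open>1 / y n\<close>, while
        \<open>M + e \<le> y n + (M + 1)\<close>.\<close>
      define e where "e = nat \<lfloor>y n + 1\<rfloor>"
      have e: "y n \<le> real e" "real e \<le> y n + 1" "y n + 1 \<le> real (Suc e)"
        using elim(2) by (auto simp: e_def) linarith+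
      have "{Q. max_degree Q \<le> M + e} \<subseteq> {Q :: nat ugraph. real (max_degree Q) \<le> y n + real (M + 1)}"
      proof safe
        fix Q :: "nat ugraph" assume "max_degree Q \<le> M + e"
        then have "real (max_degree Q) \<le> real (M + e)" by (simp only: of_nat_le_iff)
        then show "real (max_degree Q) \<le> y n + real (M + 1)" using e(2) by simp
      qed
      then have "?P n {Q. max_degree Q \<le> M + e} \<le> ?P n {Q. real (max_degree Q) \<le> y n + real (M + 1)}"
        by (intro measure_pmf.finite_measure_mono) auto
      moreover have "1 - ?P n {Q. max_degree Q \<le> M + e} \<le> real (q n) / fact (Suc e) + 1 / fact e"
        using elim M(1) nonempty by (intro prob_max_degree_le) auto
      moreover have "real (q n) / fact (Suc e) \<le> y n powr - 1"
        using elim e(3) unfolding y_def by (intro divide_fact_le) auto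
      moreover have "(1 :: real) / fact e \<le> 1 / y n"
        using elim e(1) by (intro inverse_fact_le) auto
      ultimately show ?case by linarith
    qed
  qed
  then have part1: "\<exists>K::real. (\<lambda>n. ?P n {Q. real (max_degree Q) \<le> \<mu> (real (q n)) + K}) \<longlonglongrightarrow> 1"
    unfolding y_def by blast

  have part2: "(\<lambda>n. ?P n {Q. \<lfloor>\<mu> (real (q n)) - \<epsilon>\<rfloor> + 1 \<le> int (max_degree Q) \<and>
             int (max_degree Q) \<le> \<lfloor>\<mu> (real (q n)) + \<epsilon>\<rfloor> + 1}) \<longlonglongrightarrow> 1"
    if \<beta>: "0 < \<beta>" and k_O: "(\<lambda>n. real (card (verts (C n)))) \<in> O(\<lambda>n. real (q n) powr (1 - \<beta>))" for \<beta>
  proof -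
    obtain c where c: "0 < c"
      "eventually (\<lambda>n. norm (real (k n)) \<le> c * norm (real (q n) powr (1 - \<beta>))) sequentially"
      using k_O unfolding k_def by (rule landau_o.bigE)
    \<comment> \<open>From \<open>y n \<le> ln (q n)\<close>, the proportion of core vertices, of
      order \<open>q powr - \<beta>\<close>, is exponentially small in \<open>y n\<close>.\<close>
    have few: "eventually (\<lambda>n. real (k n) \<le> c * exp (- \<beta> * y n) * real (q n) \<and> exp (y n) \<le> real (q n)) sequentially"
      using c(2) q_pos y_ge[of "exp 2"]
    proof eventually_elim
      case (elim n)
      have ey: "exp (y n) \<le> real (q n)"
        using elim unfolding y_def by (intro exp_\<mu>_le) auto
      then have "y n \<le> ln (real (q n))" using elim(2) by (simp add: ln_ge_iff)
      then have "exp (- \<beta> * ln (real (q n))) \<le> exp (- \<beta> * y n)" using \<beta> by simp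
      then have "real (q n) powr (- \<beta>) \<le> exp (- \<beta> * y n)"
        using elim(2) by (simp add: powr_def)
      moreover have "real (q n) powr (1 - \<beta>) = real (q n) powr (- \<beta>) * real (q n)"
        using elim(2) by (simp add: powr_diff powr_minus divide_inverse mult.commute)
      ultimately have "c * real (q n) powr (1 - \<beta>) \<le> c * (exp (- \<beta> * y n) * real (q n))"
        using c(1) by (intro mult_left_mono) (auto intro: mult_right_mono)
      then show ?case using elim(1) ey by (simp add: mult.assoc)
    qed

    have upper: "(\<lambda>n. ?P n {Q. int (max_degree Q) \<le> \<lfloor>y n + \<epsilon>\<rfloor> + 1}) \<longlonglongrightarrow> 1"
    proof (rule prob_tendsto_1)
      let ?f = "\<lambda>y::real. y powr - \<epsilon> + 1 / (y + \<epsilon> - 1) +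
        (c * (exp (- \<beta> * y) * (y + \<epsilon> + 1) ^ M) + 1 / (y + \<epsilon> - 1 - real M))"
      show "(\<lambda>n. ?f (y n)) \<longlonglongrightarrow> 0"
      proof (rule lim)
        have "((\<lambda>y. y powr - \<epsilon>) \<longlongrightarrow> 0) at_top" using eps by real_asymp
        moreover have "((\<lambda>y. 1 / (y + \<epsilon> - 1)) \<longlongrightarrow> 0) at_top" by real_asymp
        moreover have "((\<lambda>y. exp (- \<beta> * y) * (y + \<epsilon> + 1) ^ M) \<longlongrightarrow> 0) at_top"
          using \<beta> by real_asymp
        moreover have "((\<lambda>y. 1 / (y + \<epsilon> - 1 - real M)) \<longlongrightarrow> 0) at_top" by real_asymp
        ultimately show "(?f \<longlongrightarrow> 0) at_top"
          by (auto intro!: tendsto_add_zero tendsto_mult_right_zero)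
      qed
      show "eventually (\<lambda>n. 1 - ?P n {Q. int (max_degree Q) \<le> \<lfloor>y n + \<epsilon>\<rfloor> + 1} \<le> ?f (y n)) sequentially"
        using q_pos y_ge[of "real M + 2"] M(2) few
      proof eventually_elim
        case (elim n)
        \<comment> \<open>Now \<open>Suc e\<close> is both the bound on the degree and a number of
          children at least \<open>\<epsilon>\<close> above \<open>y n\<close>: a non-root of degree
          above \<open>Suc e\<close> has at least \<open>Suc e\<close> children.\<close>
        define e where "e = nat \<lfloor>y n + \<epsilon>\<rfloor>"
        have e: "int e = \<lfloor>y n + \<epsilon>\<rfloor>" "y n + \<epsilon> - 1 \<le> real e" "real e \<le> y n + \<epsilon>" "y n + \<epsilon> \<le> real (Suc e)" "M \<le> e"
          using elim(2) eps by (auto simp: e_def) linarith+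
        have "{Q :: nat ugraph. int (max_degree Q) \<le> \<lfloor>y n + \<epsilon>\<rfloor> + 1} = {Q. max_degree Q \<le> Suc e}"
          unfolding e(1)[symmetric] by auto
        moreover have "1 - ?P n {Q. max_degree Q \<le> Suc e} \<le> (real (q n) / fact (Suc e) + 1 / fact e) +
          (real (k n) / fact (Suc (e - M)) + 1 / fact (e - M))"
          unfolding k_def using elim e nonempty by (intro prob_max_degree_le_few_roots) auto
        moreover have qD: "real (q n) / fact (Suc e) \<le> y n powr - \<epsilon>"
          using elim e(4) eps unfolding y_def by (intro divide_fact_le) auto
        moreover have "(1 :: real) / fact e \<le> 1 / (y n + \<epsilon> - 1)"
          using elim e(2) eps by (intro inverse_fact_le) auto
        moreover have "(1 :: real) / fact (e - M) \<le> 1 / (y n + \<epsilon> - 1 - real M)"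
          using elim e(2,5) eps by (intro inverse_fact_le) (auto simp: of_nat_diff)
        \<comment> \<open>For roots, the loss of \<open>(y n + \<epsilon> + 1) ^ M\<close> from the
          lower threshold is outweighed by \<open>exp (- \<beta> * y n)\<close>.\<close>
        moreover have "real (k n) / fact (Suc (e - M)) \<le> c * (exp (- \<beta> * y n) * (y n + \<epsilon> + 1) ^ M)"
        proof -
          have "fact (Suc e) \<le> fact (Suc (e - M)) * real (Suc e) ^ M"
            using fact_le_fact_diff_power[of M "Suc e"] e(5) by (simp add: Suc_diff_le del: fact_Suc)
          also have "\<dots> \<le> fact (Suc (e - M)) * (y n + \<epsilon> + 1) ^ M"
            using e(3) by (intro mult_left_mono power_mono) auto
          finally have "1 / fact (Suc (e - M)) \<le> (y n + \<epsilon> + 1) ^ M / fact (Suc e)"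
            by (simp add: field_simps del: fact_Suc)
          then have "real (k n) * (1 / fact (Suc (e - M))) \<le>
            (c * exp (- \<beta> * y n) * real (q n)) * ((y n + \<epsilon> + 1) ^ M / fact (Suc e))"
            using elim(4) c(1) by (intro mult_mono) (auto simp del: fact_Suc)
          also have "\<dots> = c * (exp (- \<beta> * y n) * (y n + \<epsilon> + 1) ^ M) * (real (q n) / fact (Suc e))"
            by simp
          also have "\<dots> \<le> c * (exp (- \<beta> * y n) * (y n + \<epsilon> + 1) ^ M) * 1"
          proof (intro mult_left_mono)
            have "y n powr - \<epsilon> \<le> 1"
              using elim(2) eps by (simp add: powr_minus ge_one_powr_ge_zero inverse_le_1_iff)
            then show "real (q n) / fact (Suc e) \<le> 1" using qD by linarith
          qed (use c(1) elim(2) eps in auto)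
          finally show ?thesis by simp
        qed
        ultimately show ?case by simp
      qed
    qed

    have lower: "(\<lambda>n. ?P n {Q. \<lfloor>y n - \<epsilon>\<rfloor> + 1 \<le> int (max_degree Q)}) \<longlonglongrightarrow> 1"
    proof (rule prob_tendsto_1)
      \<comment> \<open>An upper bound for \<open>(k + 1 + d) / q\<close>: the first summand covers
        \<open>k / q\<close>, the second \<open>(1 + d) / q\<close>, by \<open>d \<le> y\<close> and
        \<open>exp y \<le> q\<close>.\<close>
      let ?g = "\<lambda>y::real. c * exp (- \<beta> * y) + (1 + y) * exp (- y)"
      let ?f = "\<lambda>y::real. exp (1 + 2 * (y * ?g y)) * (2 * exp (1 - \<epsilon> * ln (y - \<epsilon> - 1))) +
        (exp (2 * y / (exp y - 1)) - 1)"
      have yg: "((\<lambda>y. y * ?g y) \<longlongrightarrow> 0) at_top"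
      proof -
        have "((\<lambda>y. c * (y * exp (- \<beta> * y)) + y * ((1 + y) * exp (- y))) \<longlongrightarrow> 0) at_top"
        proof (intro tendsto_add_zero tendsto_mult_right_zero)
          show "((\<lambda>y. y * exp (- \<beta> * y)) \<longlongrightarrow> 0) at_top" using \<beta> by real_asymp
          show "((\<lambda>y::real. y * ((1 + y) * exp (- y))) \<longlongrightarrow> 0) at_top" by real_asymp
        qed
        then show ?thesis by (simp add: algebra_simps)
      qed
      show "(\<lambda>n. ?f (y n)) \<longlonglongrightarrow> 0"
      proof (rule lim)
        have "((\<lambda>y. exp (1 + 2 * (y * ?g y))) \<longlongrightarrow> exp (1 + 2 * 0)) at_top"
          by (intro tendsto_intros yg)
        moreover have "((\<lambda>y. 2 * exp (1 - \<epsilon> * ln (y - \<epsilon> - 1))) \<longlongrightarrow> 0) at_top"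
          using eps by real_asymp
        ultimately have "((\<lambda>y. exp (1 + 2 * (y * ?g y)) * (2 * exp (1 - \<epsilon> * ln (y - \<epsilon> - 1)))) \<longlongrightarrow>
          exp (1 + 2 * 0) * 0) at_top"
          by (rule tendsto_mult)
        moreover have "((\<lambda>y::real. exp (2 * y / (exp y - 1)) - 1) \<longlongrightarrow> 0) at_top" by real_asymp
        ultimately show "(?f \<longlongrightarrow> 0) at_top"
          using tendsto_add by fastforce
      qed
      \<comment> \<open>With \<open>y n \<ge> 1\<close> this gives
        \<open>k + 1 + d \<le> q / 4\<close>, so that the denominators in
        \<open>prob_max_degree_ge\<close> are at least \<open>q / 2\<close> and its condition on
        \<open>d\<close> holds.\<close>
      have "eventually (\<lambda>n. y n * ?g (y n) < 1 / 4) sequentially"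
        using lim[OF yg] by (rule order_tendstoD) simp
      then show "eventually (\<lambda>n. 1 - ?P n {Q. \<lfloor>y n - \<epsilon>\<rfloor> + 1 \<le> int (max_degree Q)} \<le> ?f (y n)) sequentially"
        using q_pos y_ge[of "\<epsilon> + 3"] few
      proof eventually_elim
        case (elim n)
        \<comment> \<open>With the parent edge, \<open>d\<close> children give exactly the required
          degree \<open>\<lfloor>y n - \<epsilon>\<rfloor> + 1\<close>, while \<open>d\<close> stays
          \<open>\<epsilon>\<close> below \<open>y n\<close>, which makes \<open>fact d / q\<close>
          tend to 0.\<close>
        define d where "d = nat \<lfloor>y n - \<epsilon>\<rfloor>"
        have d: "int d = \<lfloor>y n - \<epsilon>\<rfloor>" "y n - \<epsilon> - 1 \<le> real d" "real d + \<epsilon> \<le> y n" "1 \<le> d"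
          using elim(3) eps by (auto simp: d_def) linarith+
        define Y g where "Y = y n" and "g = ?g Y"
        have Y: "3 \<le> Y" "real d \<le> Y" "Y * g < 1 / 4" "exp Y \<le> real (q n)"
          using elim d(3) eps by (auto simp: Y_def g_def)
        have "0 \<le> g" using Y(1) c(1) by (simp add: g_def)
        then have "g \<le> Y * g" using Y(1) mult_right_mono[of 1 Y g] by simp
        then have g4: "g < 1 / 4" using Y(3) by linarith
        have small: "real (k n) + 1 + real d \<le> g * real (q n)"
        proof -
          have "1 + real d \<le> (1 + Y) * (exp (- Y) * exp Y)"
            using Y(2) by (simp add: exp_minus)
          also have "\<dots> \<le> (1 + Y) * (exp (- Y) * real (q n))"
            using Y by (intro mult_left_mono) auto
          finally have "1 + real d \<le> (1 + Y) * exp (- Y) * real (q n)" by (simp add: mult.assoc)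
          then show ?thesis
            using elim(4) by (simp add: g_def Y_def distrib_right)
        qed
        have q0: "0 < real (q n)" using elim(2) by simp
        then have gq: "g * real (q n) \<le> real (q n) / 4"
          using g4 mult_right_mono[of g "1 / 4" "real (q n)"] by simp
        have half: "real (q n) / 2 \<le> real (q n) - real (k n) - 1 - real d"
          using small gq q0 by linarith
        have "real (2 * d + k n + 1) = 2 * real d + real (k n) + 1" by simp
        then have "real (2 * d + k n + 1) < real (q n)"
          using small gq q0 by linarith
        then have dk: "2 * d + k n + 1 < q n" by (simp only: of_nat_less_iff)
        have "{Q :: nat ugraph. \<lfloor>y n - \<epsilon>\<rfloor> + 1 \<le> int (max_degree Q)} = {Q. Suc d \<le> max_degree Q}"
          unfolding d(1)[symmetric] by auto
        moreover have "1 - ?P n {Q. Suc d \<le> max_degree Q} \<le>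
          exp (1 + real d * (real (k n) + 1 + real d) / (real (q n) - real (k n) - 1 - real d)) *
            fact d / (real (q n) - real (k n)) + (exp (2 * real d / (real (q n) - 1)) - 1)"
          using prob_max_degree_ge[OF nonempty, of d n] dk by (simp add: k_def)
        moreover have "exp (1 + real d * (real (k n) + 1 + real d) / (real (q n) - real (k n) - 1 - real d)) *
            fact d / (real (q n) - real (k n)) \<le>
          exp (1 + 2 * (Y * g)) * (2 * exp (1 - \<epsilon> * ln (Y - \<epsilon> - 1)))"
        proof -
          have "real d * (real (k n) + 1 + real d) / (real (q n) - real (k n) - 1 - real d) \<le>
            Y * (g * real (q n)) / (real (q n) / 2)"
            using Y small half q0 by (intro frac_le mult_mono) auto
          also have "\<dots> = 2 * (Y * g)" using q0 by simp
          finally have 1: "exp (1 + real d * (real (k n) + 1 + real d) / (real (q n) - real (k n) - 1 - real d))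
            \<le> exp (1 + 2 * (Y * g))" by simp
          have "fact d / (real (q n) - real (k n)) \<le> fact d / (real (q n) / 2)"
            using half q0 by (intro divide_left_mono) auto
          also have "\<dots> = 2 * (fact d / real (q n))" by simp
          also have "fact d / real (q n) \<le> exp (1 - \<epsilon> * ln (real d))"
            using q0 d eps unfolding y_def by (intro fact_divide_le) auto
          also have "\<dots> \<le> exp (1 - \<epsilon> * ln (Y - \<epsilon> - 1))"
          proof -
            have "ln (Y - \<epsilon> - 1) \<le> ln (real d)"
              using d(2) elim(3) by (subst ln_le_cancel_iff) (auto simp: Y_def)
            then show ?thesis using eps by simp
          qed
          finally have 2: "fact d / (real (q n) - real (k n)) \<le> 2 * exp (1 - \<epsilon> * ln (Y - \<epsilon> - 1))" by simp
          have "0 \<le> fact d / (real (q n) - real (k n))" using half q0 by simp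
          then show ?thesis
            using mult_mono[OF 1 2] by simp
        qed
        moreover have "exp (2 * real d / (real (q n) - 1)) \<le> exp (2 * Y / (exp Y - 1))"
        proof -
          have "1 < exp Y" using Y(1) by simp
          then have "2 * real d / (real (q n) - 1) \<le> 2 * Y / (exp Y - 1)"
            using Y by (intro frac_le) auto
          then show ?thesis by simp
        qed
        ultimately show ?case by (simp add: Y_def g_def del: exp_le_cancel_iff)
      qed
    qed
    show ?thesis
      using prob_Int_tendsto_1[OF lower upper] unfolding y_def Collect_conj_eq .
  qed
  from part1 part2 show ?thesis by blast
qed

end
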